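(* Let $G$ be the Cayley graph of the Coxeter system $\mathbf{B_n}$ ($n\ge2$) or $\mathbf{D_n}$ ($n\ge 3$) with respect to its standard Coxeter generators. Then $\sigma(G)\le\lceil\sqrt{\kappa(G)}\rceil+1$.
   Context: $\mathbf{B_n}$ is the Coxeter group with generators $s_1,\dots,s_n$ and relations $s_i^2=1$, $(s_1s_2)^4=1$, $(s_is_{i+1})^3=1$ for $2\le i\le n-1$, and $(s_is_j)^2=1$ for $|i-j|\ge2$. $\mathbf{D_n}$ is the Coxeter group with generators $s_1,\dots,s_n$ and relations $s_i^2=1$, $(s_1s_3)^3=(s_2s_3)^3=1$, $(s_is_{i+1})^3=1$ for $3\le i\le n-1$, and $(s_is_j)^2=1$ for all other pairs $i\ne j$. The Cayley graph has $x\sim y$ iff $x^{-1}y$ is a generator. $\kappa(G)$ is the largest $d$ with the hypercube $Q_d$ a subgraph of $G$; $\sigma(G)$ is the minimum of the maximum degree of $G[K]$ over vertex sets $K$ with $|K|>\alpha(G)$, $\alpha$ the independence number. *)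

theory Defs
  imports Complex_Main "HOL-Algebra.Group" "Graph_Theory.Graph_Theory"
begin

section \<open>Groups given by generators and relations\<close>

text \<open>
  Words in a set \<open>X\<close> of generators and their formal inverses: the letter \<open>(a, True)\<close> stands
  for the generator \<open>a\<close>, the letter \<open>(a, False)\<close> for its inverse.
\<close>

type_synonym 'a gword = "('a \<times> bool) list"

definition gwords :: "'a set \<Rightarrow> 'a gword set" where
  "gwords X = lists (X \<times> UNIV)"

text \<open>
  Equality of words in the presented group \<open>\<langle>X | R\<rangle>\<close>: insertion and deletion of
  \<open>a a\<^sup>-\<^sup>1\<close>, \<open>a\<^sup>-\<^sup>1 a\<close> and of relators, at any place in a word.
\<close>

inductive pres_eq :: "'a set \<Rightarrow> 'a gword set \<Rightarrow> 'a gword \<Rightarrow> 'a gword \<Rightarrow> bool"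
  for X :: "'a set" and R :: "'a gword set" where
  refl: "w \<in> gwords X \<Longrightarrow> pres_eq X R w w"
| sym: "pres_eq X R v w \<Longrightarrow> pres_eq X R w v"
| trans: "pres_eq X R u v \<Longrightarrow> pres_eq X R v w \<Longrightarrow> pres_eq X R u w"
| cancel: "u \<in> gwords X \<Longrightarrow> v \<in> gwords X \<Longrightarrow> a \<in> X \<Longrightarrow>
    pres_eq X R (u @ [(a, b), (a, \<not> b)] @ v) (u @ v)"
| relator: "u \<in> gwords X \<Longrightarrow> v \<in> gwords X \<Longrightarrow> r \<in> R \<Longrightarrow> r \<in> gwords X \<Longrightarrow>
    pres_eq X R (u @ r @ v) (u @ v)"

definition pres_class :: "'a set \<Rightarrow> 'a gword set \<Rightarrow> 'a gword \<Rightarrow> 'a gword set" where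
  "pres_class X R w = {v. pres_eq X R w v}"

definition presented_group :: "'a set \<Rightarrow> 'a gword set \<Rightarrow> 'a gword set monoid" where
  "presented_group X R =
    \<lparr> carrier = pres_class X R ` gwords X,
      monoid.mult = (\<lambda>A B. \<Union>u\<in>A. \<Union>v\<in>B. pres_class X R (u @ v)),
      one = pres_class X R [] \<rparr>"

definition presented_gens :: "'a set \<Rightarrow> 'a gword set \<Rightarrow> 'a gword set set" where
  "presented_gens X R = (\<lambda>a. pres_class X R [(a, True)]) ` X"

lemma gwords_simps [simp]:
  "[] \<in> gwords X"
  "u @ v \<in> gwords X \<longleftrightarrow> u \<in> gwords X \<and> v \<in> gwords X"
  "(a, b) # w \<in> gwords X \<longleftrightarrow> a \<in> X \<and> w \<in> gwords X"
  by (auto simp: gwords_def)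

lemma pres_eq_gwords: "pres_eq X R v w \<Longrightarrow> v \<in> gwords X \<and> w \<in> gwords X"
  by (induction rule: pres_eq.induct) auto

lemma pres_eq_context:
  "pres_eq X R v w \<Longrightarrow> p \<in> gwords X \<Longrightarrow> q \<in> gwords X \<Longrightarrow> pres_eq X R (p @ v @ q) (p @ w @ q)"
proof (induction rule: pres_eq.induct)
  case (sym v w)
  then show ?case by (blast intro: pres_eq.sym)
next
  case (trans u v w)
  then show ?case using pres_eq.trans[of X R "p @ u @ q" "p @ v @ q" "p @ w @ q"] by simp
next
  case (cancel u v a b)
  then show ?case using pres_eq.cancel[of "p @ u" X "v @ q" a R b] by simp
next
  case (relator u v r)
  then show ?case using pres_eq.relator[of "p @ u" X "v @ q" r R] by simp
qed (simp_all add: pres_eq.refl)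

lemma pres_eq_append:
  assumes "pres_eq X R u u'" "pres_eq X R v v'"
  shows "pres_eq X R (u @ v) (u' @ v')"
proof -
  have "pres_eq X R (u @ v) (u' @ v)"
    using pres_eq_context[OF assms(1), of "[]" v] pres_eq_gwords[OF assms(2)] by simp
  moreover have "pres_eq X R (u' @ v) (u' @ v')"
    using pres_eq_context[OF assms(2), of u' "[]"] pres_eq_gwords[OF assms(1)] by simp
  ultimately show ?thesis by (rule pres_eq.trans)
qed

lemma pres_class_eq_iff:
  assumes "w \<in> gwords X"
  shows "pres_class X R v = pres_class X R w \<longleftrightarrow> pres_eq X R v w"
proof
  assume "pres_class X R v = pres_class X R w"
  moreover have "w \<in> pres_class X R w"
    using assms by (simp add: pres_class_def pres_eq.refl)
  ultimately show "pres_eq X R v w" by (simp add: pres_class_def set_eq_iff)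
next
  assume vw: "pres_eq X R v w"
  show "pres_class X R v = pres_class X R w"
    unfolding pres_class_def
    using pres_eq.trans[OF vw] pres_eq.trans[OF pres_eq.sym[OF vw]] by (intro Collect_cong iffI)
qed

lemma presented_group_mult:
  assumes "u \<in> gwords X" "v \<in> gwords X"
  shows "pres_class X R u \<otimes>\<^bsub>presented_group X R\<^esub> pres_class X R v = pres_class X R (u @ v)"
proof -
  have "pres_class X R (u' @ v') = pres_class X R (u @ v)"
    if "u' \<in> pres_class X R u" "v' \<in> pres_class X R v" for u' v'
  proof -
    have "pres_eq X R (u' @ v') (u @ v)"
      using that by (intro pres_eq.sym[OF pres_eq_append]) (simp_all add: pres_class_def)
    then show ?thesis using assms by (simp add: pres_class_eq_iff)
  qed
  then have "(\<Union>u'\<in>pres_class X R u. \<Union>v'\<in>pres_class X R v. pres_class X R (u' @ v')) =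
      (\<Union>u'\<in>pres_class X R u. \<Union>v'\<in>pres_class X R v. pres_class X R (u @ v))"
    by (intro SUP_cong HOL.refl)
  moreover have "u \<in> pres_class X R u" "v \<in> pres_class X R v"
    using assms by (auto simp: pres_class_def intro: pres_eq.refl)
  ultimately show ?thesis
    unfolding presented_group_def by (simp only: monoid.simps) blast
qed

lemma pres_eq_formal_inverse:
  assumes "w \<in> gwords X"
  shows "map (\<lambda>(a, b). (a, \<not> b)) (rev w) \<in> gwords X \<and>
    pres_eq X R (map (\<lambda>(a, b). (a, \<not> b)) (rev w) @ w) []"
  using assms
proof (induction w)
  case Nil
  then show ?case by (simp add: pres_eq.refl)
next
  case (Cons l w)
  obtain a b where l: "l = (a, b)" by (cases l)
  let ?i = "map (\<lambda>(a, b). (a, \<not> b)) (rev w)"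
  from Cons l have w: "a \<in> X" "w \<in> gwords X" "?i \<in> gwords X" "pres_eq X R (?i @ w) []"
    by auto
  then have "pres_eq X R (?i @ [(a, \<not> b), (a, \<not> \<not> b)] @ w) (?i @ w)"
    by (intro pres_eq.cancel)
  from pres_eq.trans[OF this w(4)]
  have "pres_eq X R (?i @ [(a, \<not> b), (a, \<not> \<not> b)] @ w) []" .
  with w show ?case by (simp add: l)
qed

lemma group_presented_group: "group (presented_group X R)"
proof (rule groupI)
  let ?G = "presented_group X R"
  have car: "carrier ?G = pres_class X R ` gwords X"
    and one: "\<one>\<^bsub>?G\<^esub> = pres_class X R []"
    by (simp_all add: presented_group_def)
  show "\<one>\<^bsub>?G\<^esub> \<in> carrier ?G" by (simp add: car one)
  show "x \<otimes>\<^bsub>?G\<^esub> y \<in> carrier ?G" if "x \<in> carrier ?G" "y \<in> carrier ?G" for x y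
    using that by (auto simp: car presented_group_mult)
  show "x \<otimes>\<^bsub>?G\<^esub> y \<otimes>\<^bsub>?G\<^esub> z = x \<otimes>\<^bsub>?G\<^esub> (y \<otimes>\<^bsub>?G\<^esub> z)"
    if "x \<in> carrier ?G" "y \<in> carrier ?G" "z \<in> carrier ?G" for x y z
    using that by (auto simp: car presented_group_mult)
  show "\<one>\<^bsub>?G\<^esub> \<otimes>\<^bsub>?G\<^esub> x = x" if "x \<in> carrier ?G" for x
    using that by (auto simp: car one presented_group_mult)
  show "\<exists>y\<in>carrier ?G. y \<otimes>\<^bsub>?G\<^esub> x = \<one>\<^bsub>?G\<^esub>" if "x \<in> carrier ?G" for x
  proof -
    from that obtain w where w: "w \<in> gwords X" "x = pres_class X R w" by (auto simp: car)
    let ?i = "map (\<lambda>(a, b). (a, \<not> b)) (rev w)"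
    from pres_eq_formal_inverse[OF w(1)]
    have i: "?i \<in> gwords X" "pres_eq X R (?i @ w) []" by blast+
    then have "pres_class X R ?i \<otimes>\<^bsub>?G\<^esub> x = \<one>\<^bsub>?G\<^esub>"
      using w by (simp add: one presented_group_mult pres_class_eq_iff)
    with i(1) show ?thesis by (auto simp: car)
  qed
qed


section \<open>The Coxeter systems of types B and D\<close>

definition pair_power :: "nat \<Rightarrow> nat \<Rightarrow> nat \<Rightarrow> nat gword" where
  "pair_power i j k = concat (replicate k [(i, True), (j, True)])"

definition B_relators :: "nat \<Rightarrow> nat gword set" where
  "B_relators n =
     {[(i, True), (i, True)] | i. i \<in> {1..n}}
   \<union> {pair_power 1 2 4}
   \<union> {pair_power i (i + 1) 3 | i. 2 \<le> i \<and> i + 1 \<le> n}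
   \<union> {pair_power i j 2 | i j. i \<in> {1..n} \<and> j \<in> {1..n} \<and> \<bar>int i - int j\<bar> \<ge> 2}"

text \<open>The edges of the Coxeter diagram of type D, where the node 3 is joined to 1, 2 and 4.\<close>

definition D_edges :: "nat \<Rightarrow> (nat \<times> nat) set" where
  "D_edges n = {(1, 3), (2, 3)} \<union> {(i, i + 1) | i. 3 \<le> i \<and> i + 1 \<le> n}"

definition D_relators :: "nat \<Rightarrow> nat gword set" where
  "D_relators n =
     {[(i, True), (i, True)] | i. i \<in> {1..n}}
   \<union> {pair_power i j 3 | i j. (i, j) \<in> D_edges n}
   \<union> {pair_power i j 2 | i j. i \<in> {1..n} \<and> j \<in> {1..n} \<and> i \<noteq> j
        \<and> (i, j) \<notin> D_edges n \<and> (j, i) \<notin> D_edges n}"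


section \<open>Cayley graphs and graph parameters\<close>

text \<open>Undirected simple graphs are symmetric loop-free digraphs without parallel arcs.\<close>

definition cayley_graph :: "('a, 'b) monoid_scheme \<Rightarrow> 'a set \<Rightarrow> 'a pair_pre_digraph" where
  "cayley_graph G S =
    \<lparr> pverts = carrier G,
      parcs = {(x, y). x \<in> carrier G \<and> y \<in> carrier G \<and> inv\<^bsub>G\<^esub> x \<otimes>\<^bsub>G\<^esub> y \<in> S} \<rparr>"

definition cayley_B :: "nat \<Rightarrow> nat gword set pair_pre_digraph" where
  "cayley_B n = cayley_graph (presented_group {1..n} (B_relators n))
                             (presented_gens {1..n} (B_relators n))"

definition cayley_D :: "nat \<Rightarrow> nat gword set pair_pre_digraph" where
  "cayley_D n = cayley_graph (presented_group {1..n} (D_relators n))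
                             (presented_gens {1..n} (D_relators n))"

definition hypercube :: "nat \<Rightarrow> bool list pair_pre_digraph" where
  "hypercube d =
    \<lparr> pverts = {x. length x = d},
      parcs = {(x, y). length x = d \<and> length y = d \<and> card {i. i < d \<and> x ! i \<noteq> y ! i} = 1} \<rparr>"

text \<open>The subgraph isomorphic to the hypercube need not be an induced one.\<close>

definition kappa :: "'a pair_pre_digraph \<Rightarrow> nat" where
  "kappa G = Max {d. \<exists>H :: 'a pair_pre_digraph.
      subgraph (with_proj H) (with_proj G) \<and> digraph_iso (with_proj (hypercube d)) (with_proj H)}"

definition independent_set :: "'a pair_pre_digraph \<Rightarrow> 'a set \<Rightarrow> bool" where
  "independent_set G I \<longleftrightarrow> I \<subseteq> pverts G \<and> (\<forall>u\<in>I. \<forall>v\<in>I. (u, v) \<notin> parcs G)"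

definition independence_number :: "'a pair_pre_digraph \<Rightarrow> nat" where
  "independence_number G = Max {card I | I. independent_set G I}"

definition max_degree :: "('a, 'b) pre_digraph \<Rightarrow> nat" where
  "max_degree H = Max (out_degree H ` verts H)"

definition sigma :: "'a pair_pre_digraph \<Rightarrow> nat" where
  "sigma G = Min {max_degree (with_proj G \<restriction> K) | K.
      K \<subseteq> pverts G \<and> card K > independence_number G}"

end

(*
  Sending s_j to the transposition (j-2, j-1) for j \<ge> 2, and s_1 to (n, n+1) in type B and to
  (0, 1) in type D, defines an antihomomorphism P from the Coxeter group W to permutations. Its
  sign makes the Cayley graph bipartite, and the perfect matching x -- x s_2 gives \<alpha> \<le> |W|/2.
  With m = n div 2, the commuting generators s_2, s_4, ..., s_{2m} span a cube, so \<kappa> \<ge> m.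

  For i < m let inv_i(x) say that P x inverts the pair {2i, 2i+1}. Right multiplication by s_j,
  j \<ge> 2, swaps two adjacent values, so it changes at most one of these bits, and each bit is changed
  by at most one such s_j. Let k = \<lceil>sqrt m\<rceil>, cut the m bits into blocks of length k, negate the first
  bit of each block, and let Y be the set of x with P x n = n for which the AND over the blocks of
  the OR over each block is true. This function of m bits has sensitivity at most k, so in
  K = {x. sign (P x) = 1 \<longleftrightarrow> x \<in> Y} every vertex has at most k + 1 neighbours, one of them coming
  from s_1. Finally |K| = |W|/2 + (\<Sum>x\<in>Y. sign (P x)), and the sum is positive: two sign reversing
  involutions leave only the x that permute the pairs {2i, 2i+1} without inverting any, and these
  are even.
*)
theory Submission
  imports Defs "HOL-Combinatorics.Permutations"
begin

section \<open>Finiteness of the Coxeter groups of types B and D\<close>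

context monoid_mult
begin

text \<open>For involutory generators this is the parabolic subgroup on the first \<open>k\<close>
  nodes of the diagram.\<close>

definition words :: "(nat \<Rightarrow> 'a) \<Rightarrow> nat \<Rightarrow> 'a set" where
  "words s k = (\<lambda>w. prod_list (map s w)) ` lists {1..k}"

text \<open>These products represent the cosets in type A; \<open>i = Suc k\<close> gives the empty
  product, the trivial coset.\<close>

definition descent :: "(nat \<Rightarrow> 'a) \<Rightarrow> nat \<Rightarrow> nat \<Rightarrow> 'a" where
  "descent s k i = prod_list (map s (rev [i..<Suc k]))"

definition ascent :: "(nat \<Rightarrow> 'a) \<Rightarrow> nat \<Rightarrow> nat \<Rightarrow> 'a" where
  "ascent s b i = prod_list (map s [b..<Suc i])"

lemma one_in_words: "1 \<in> words s k"
  unfolding words_def by (rule image_eqI[of _ _ "[]"]) auto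

lemma gen_in_words: "1 \<le> i \<Longrightarrow> i \<le> k \<Longrightarrow> s i \<in> words s k"
  unfolding words_def by (rule image_eqI[of _ _ "[i]"]) auto

lemma mult_in_words:
  assumes "g \<in> words s k" "h \<in> words s k"
  shows "g * h \<in> words s k"
proof -
  from assms obtain u v where "u \<in> lists {1..k}" "v \<in> lists {1..k}"
    "g = prod_list (map s u)" "h = prod_list (map s v)" unfolding words_def by blast
  then show ?thesis unfolding words_def by (intro image_eqI[of _ _ "u @ v"]) auto
qed

lemma finite_words_0: "finite (words s 0)"
  by (simp add: words_def)

text \<open>Coset enumeration: \<open>T\<close> contains representatives of the cosets \<open>words s k * t\<close>.\<close>

lemma finite_words_Suc:
  assumes fin: "finite (words s k)" "finite T" and one: "1 \<in> T"
    and step: "\<And>t j. t \<in> T \<Longrightarrow> 1 \<le> j \<Longrightarrow> j \<le> Suc k \<Longrightarrow>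
      \<exists>h\<in>words s k. \<exists>t'\<in>T. t * s j = h * t'"
  shows "finite (words s (Suc k))"
proof (rule finite_subset)
  have "\<exists>h\<in>words s k. \<exists>t\<in>T. prod_list (map s w) = h * t" if "w \<in> lists {1..Suc k}" for w
    using that
  proof (induction w rule: rev_induct)
    case Nil
    show ?case using one one_in_words[of s k] by (intro bexI[of _ 1]) auto
  next
    case (snoc j w)
    then obtain h t where ht: "h \<in> words s k" "t \<in> T" "prod_list (map s w) = h * t" by auto
    from snoc.prems step[OF ht(2), of j] obtain h' t' where
      "h' \<in> words s k" "t' \<in> T" "t * s j = h' * t'" by auto
    with ht show ?case
      by (intro bexI[of _ "h * h'"] bexI[of _ t'] mult_in_words) (simp_all add: mult_assoc)
  qed
  then show "words s (Suc k) \<subseteq> (\<lambda>(h, t). h * t) ` (words s k \<times> T)"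
    unfolding words_def[of s "Suc k"] by fastforce
  show "finite ((\<lambda>(h, t). h * t) ` (words s k \<times> T))"
    using fin by simp
qed

lemma prod_list_commute:
  assumes "\<And>i. i \<in> set w \<Longrightarrow> s i * x = x * s i"
  shows "prod_list (map s w) * x = x * prod_list (map s w)"
  using assms
proof (induction w)
  case (Cons i w)
  then have "s i * (prod_list (map s w) * x) = s i * (x * prod_list (map s w))" by simp
  also have "\<dots> = (s i * x) * prod_list (map s w)" by (simp add: mult_assoc)
  also have "\<dots> = x * (s i * prod_list (map s w))" using Cons.prems by (simp add: mult_assoc)
  finally show ?case by (simp add: mult_assoc)
qed simp

section \<open>Relations between two involutions\<close>

lemma left_right_inverse_eq:
  assumes "x * z = 1" "z * y = 1"
  shows "x = y"
proof -
  have "x = x * (z * y)" using assms by simp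
  also have "\<dots> = x * z * y" by (simp only: mult_assoc)
  finally show ?thesis using assms by simp
qed

lemma mult_involution_cancel: "x * x = 1 \<Longrightarrow> x * (x * y) = y"
  by (simp add: mult_assoc[symmetric])

text \<open>The hypothesis makes \<open>x * y\<close> its own inverse, and \<open>y * x\<close> is
  its inverse too. The next two lemmas use the same uniqueness of inverses for
  \<open>y * x * y\<close> and \<open>x * y * x * y\<close>.\<close>

lemma involutions_commute:
  assumes "x * x = 1" "y * y = 1" "x * (y * (x * y)) = 1"
  shows "x * y = y * x"
  by (rule left_right_inverse_eq[of _ "x * y"]) (use assms in \<open>simp_all add: mult_assoc mult_involution_cancel\<close>)

lemma involutions_braid3:
  assumes "x * x = 1" "y * y = 1" "x * (y * (x * (y * (x * y)))) = 1"
  shows "x * y * x = y * x * y"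
  by (rule left_right_inverse_eq[of _ "y * x * y"]) (use assms in \<open>simp_all add: mult_assoc mult_involution_cancel\<close>)

lemma involutions_braid4:
  assumes "x * x = 1" "y * y = 1" "x * (y * (x * (y * (x * (y * (x * y)))))) = 1"
  shows "x * y * x * y = y * x * y * x"
  by (rule left_right_inverse_eq[of _ "x * y * x * y"]) (use assms in \<open>simp_all add: mult_assoc mult_involution_cancel\<close>)

section \<open>Moving a generator through a descending or ascending product\<close>

lemma descent_empty: "descent s k (Suc k) = 1"
  by (simp add: descent_def)

lemma descent_rec: "i \<le> k \<Longrightarrow> descent s k i = descent s k (Suc i) * s i"
  by (simp add: descent_def upt_conv_Cons del: upt_Suc)

lemma descent_commute:
  assumes "\<And>l. i \<le> l \<Longrightarrow> l \<le> k \<Longrightarrow> s l * x = x * s l"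
  shows "descent s k i * x = x * descent s k i"
  unfolding descent_def using assms by (intro prod_list_commute) auto

text \<open>Coming from the right, \<open>s j\<close> commutes past the factors with index below
  \<open>j - 1\<close>; the braid relation turns \<open>s j * s (j - 1) * s j\<close> into
  \<open>s (j - 1) * s j * s (j - 1)\<close>; the new \<open>s (j - 1)\<close> commutes past the
  factors with index above \<open>j\<close>. The bound \<open>b\<close> confines this to the type A
  part of the diagram.\<close>

lemma descent_shift:
  assumes "b \<le> i" "i < j" "j \<le> k"
    and comm: "\<And>i j. b \<le> i \<Longrightarrow> i + 2 \<le> j \<Longrightarrow> j \<le> k \<Longrightarrow> s i * s j = s j * s i"
    and braid: "\<And>i. b \<le> i \<Longrightarrow> i < k \<Longrightarrow> s i * s (Suc i) * s i = s (Suc i) * s i * s (Suc i)"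
  shows "descent s k i * s j = s (j - 1) * descent s k i"
proof -
  let ?A = "prod_list (map s (rev [Suc j..<Suc k]))"
  let ?B = "prod_list (map s (rev [i..<j - 1]))"
  have "[i..<Suc k] = [i..<j - 1] @ [j - 1, j] @ [Suc j..<Suc k]"
  proof -
    have "[i..<Suc k] = [i..<j - 1] @ [j - 1..<Suc k]"
      using assms upt_add_eq_append[of i "j - 1" "Suc k - (j - 1)"] by simp
    moreover have "[j - 1..<Suc k] = [j - 1, j] @ [Suc j..<Suc k]"
      using assms by (simp add: upt_conv_Cons del: upt_Suc)
    ultimately show ?thesis by simp
  qed
  then have D: "descent s k i = ?A * (s j * (s (j - 1) * ?B))"
    by (simp add: descent_def mult_assoc del: upt_Suc)
  have B: "?B * s j = s j * ?B"
    using assms by (intro prod_list_commute comm) auto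
  have A: "?A * s (j - 1) = s (j - 1) * ?A"
    using assms by (intro prod_list_commute comm[symmetric]) auto
  have "s (j - 1) * s (Suc (j - 1)) * s (j - 1) = s (Suc (j - 1)) * s (j - 1) * s (Suc (j - 1))"
    using assms by (intro braid) auto
  then have br: "s j * (s (j - 1) * s j) = s (j - 1) * (s j * s (j - 1))"
    using assms by (simp add: mult_assoc)
  have "descent s k i * s j = ?A * (s j * (s (j - 1) * (?B * s j)))"
    by (simp only: D mult_assoc)
  also have "\<dots> = ?A * ((s j * (s (j - 1) * s j)) * ?B)"
    by (simp only: B mult_assoc)
  also have "\<dots> = (?A * s (j - 1)) * (s j * (s (j - 1) * ?B))"
    by (simp only: br mult_assoc)
  also have "\<dots> = s (j - 1) * descent s k i"
    by (simp only: A D mult_assoc)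
  finally show ?thesis .
qed

lemma ascent_empty: "ascent s (Suc i) i = 1"
  by (simp add: ascent_def)

lemma ascent_rec: "b \<le> Suc i \<Longrightarrow> ascent s b (Suc i) = ascent s b i * s (Suc i)"
  by (simp add: ascent_def)

lemma ascent_rec_left: "b \<le> i \<Longrightarrow> ascent s b i = s b * ascent s (Suc b) i"
  by (simp add: ascent_def upt_conv_Cons del: upt_Suc)

lemma ascent_commute:
  assumes "\<And>l. b \<le> l \<Longrightarrow> l \<le> i \<Longrightarrow> s l * x = x * s l"
  shows "ascent s b i * x = x * ascent s b i"
  unfolding ascent_def using assms by (intro prod_list_commute) auto

lemma ascent_shift:
  assumes "b \<le> j" "j < i" "i \<le> k"
    and comm: "\<And>i j. b \<le> i \<Longrightarrow> i + 2 \<le> j \<Longrightarrow> j \<le> k \<Longrightarrow> s i * s j = s j * s i"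
    and braid: "\<And>i. b \<le> i \<Longrightarrow> i < k \<Longrightarrow> s i * s (Suc i) * s i = s (Suc i) * s i * s (Suc i)"
  shows "ascent s b i * s j = s (Suc j) * ascent s b i"
proof -
  let ?A = "prod_list (map s [b..<j])"
  let ?B = "prod_list (map s [j + 2..<Suc i])"
  have "[b..<Suc i] = [b..<j] @ [j, Suc j] @ [j + 2..<Suc i]"
  proof -
    have "[b..<Suc i] = [b..<j] @ [j..<Suc i]"
      using assms upt_add_eq_append[of b j "Suc i - j"] by simp
    moreover have "[j..<Suc i] = [j, Suc j] @ [j + 2..<Suc i]"
      using assms by (simp add: upt_conv_Cons del: upt_Suc)
    ultimately show ?thesis by simp
  qed
  then have D: "ascent s b i = ?A * (s j * (s (Suc j) * ?B))"
    by (simp add: ascent_def mult_assoc del: upt_Suc)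
  have B: "?B * s j = s j * ?B"
    using assms by (intro prod_list_commute comm[symmetric]) auto
  have A: "?A * s (Suc j) = s (Suc j) * ?A"
    using assms by (intro prod_list_commute comm) auto
  have br: "s j * (s (Suc j) * s j) = s (Suc j) * (s j * s (Suc j))"
    using braid[of j] assms by (simp add: mult_assoc)
  have "ascent s b i * s j = ?A * (s j * (s (Suc j) * (?B * s j)))"
    by (simp only: D mult_assoc)
  also have "\<dots> = ?A * ((s j * (s (Suc j) * s j)) * ?B)"
    by (simp only: B mult_assoc)
  also have "\<dots> = (?A * s (Suc j)) * (s j * (s (Suc j) * ?B))"
    by (simp only: br mult_assoc)
  also have "\<dots> = s (Suc j) * ascent s b i"
    by (simp only: A D mult_assoc)
  finally show ?thesis .
qed

section \<open>Right multiplication of coset representatives by a generator\<close>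

lemma descent_step:
  assumes ij: "1 \<le> b" "b \<le> i" "i \<le> Suc (Suc k)" "b \<le> j" "j \<le> Suc k"
    and inv: "\<And>i. b \<le> i \<Longrightarrow> i \<le> Suc k \<Longrightarrow> s i * s i = 1"
    and comm: "\<And>i j. b \<le> i \<Longrightarrow> i + 2 \<le> j \<Longrightarrow> j \<le> Suc k \<Longrightarrow> s i * s j = s j * s i"
    and braid: "\<And>i. b \<le> i \<Longrightarrow> i < Suc k \<Longrightarrow> s i * s (Suc i) * s i = s (Suc i) * s i * s (Suc i)"
  shows "\<exists>h\<in>words s k. \<exists>i'\<in>{b..Suc (Suc k)}. descent s (Suc k) i * s j = h * descent s (Suc k) i'"
proof -
  \<comment> \<open>In turn: \<open>s j\<close> cancels the last factor, prolongs the product,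
    commutes with it, or passes through it and comes out as \<open>s (j - 1)\<close>.\<close>
  consider "j = i" | "i = Suc j" | "Suc j < i" | "i < j" by linarith
  then show ?thesis
  proof cases
    case 1
    then have "descent s (Suc k) i * s j = descent s (Suc k) (Suc i) * (s i * s i)"
      using ij by (simp only: descent_rec mult_assoc)
    then have "descent s (Suc k) i * s j = 1 * descent s (Suc k) (Suc i)"
      using 1 ij inv by simp
    moreover have "Suc i \<in> {b..Suc (Suc k)}" using ij 1 by auto
    ultimately show ?thesis using one_in_words[of s k] by (intro bexI)
  next
    case 2
    then have "descent s (Suc k) i * s j = 1 * descent s (Suc k) j"
      using ij by (simp add: descent_rec[of j])
    moreover have "j \<in> {b..Suc (Suc k)}" using ij by auto
    ultimately show ?thesis using one_in_words[of s k] by (intro bexI)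
  next
    case 3
    then have "descent s (Suc k) i * s j = s j * descent s (Suc k) i"
      using ij by (intro descent_commute comm[symmetric]) auto
    moreover have "s j \<in> words s k" using 3 ij by (intro gen_in_words) auto
    moreover have "i \<in> {b..Suc (Suc k)}" using ij by auto
    ultimately show ?thesis by (intro bexI)
  next
    case 4
    have "descent s (Suc k) i * s j = s (j - 1) * descent s (Suc k) i"
      by (intro descent_shift[where b = b] comm braid) (use 4 ij in auto)
    moreover have "s (j - 1) \<in> words s k" using 4 ij by (intro gen_in_words) auto
    moreover have "i \<in> {b..Suc (Suc k)}" using ij by auto
    ultimately show ?thesis by (intro bexI)
  qed
qed

text \<open>
  The coset representatives in type B are the initial segments of
  \<open>s k \<cdots> s 2 * s 1 * s 2 \<cdots> s k\<close>. In type D the descent stops at \<open>s 3\<close>, and \<open>s 1 * s 2\<close> takes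
  the place of the turning element \<open>s 1\<close>.
\<close>

lemma turn_step:
  assumes ij: "2 \<le> b" "b \<le> Suc i" "i \<le> Suc k" "b \<le> j" "j \<le> Suc k"
    and inv: "\<And>i. b \<le> i \<Longrightarrow> i \<le> Suc k \<Longrightarrow> s i * s i = 1"
    and comm: "\<And>i j. b \<le> i \<Longrightarrow> i + 2 \<le> j \<Longrightarrow> j \<le> Suc k \<Longrightarrow> s i * s j = s j * s i"
    and braid: "\<And>i. b \<le> i \<Longrightarrow> i < Suc k \<Longrightarrow> s i * s (Suc i) * s i = s (Suc i) * s i * s (Suc i)"
    and turn: "\<And>i. b < i \<Longrightarrow> i \<le> Suc k \<Longrightarrow> c * s i = s i * c"
  shows "\<exists>h\<in>words s k. \<exists>i'\<in>{b - 1..Suc k}.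
    descent s (Suc k) b * c * ascent s b i * s j = h * (descent s (Suc k) b * c * ascent s b i')"
proof -
  \<comment> \<open>A generator above \<open>b\<close> commutes with the turning element and drops
    by one index in the descent.\<close>
  have pass: "descent s (Suc k) b * c * s l = s (l - 1) * (descent s (Suc k) b * c)"
    if "b < l" "l \<le> Suc k" for l
  proof -
    have "descent s (Suc k) b * c * s l = descent s (Suc k) b * s l * c"
      using turn[OF that] by (simp only: mult_assoc)
    also have "descent s (Suc k) b * s l = s (l - 1) * descent s (Suc k) b"
      by (intro descent_shift[where b = b] comm braid) (use that ij in auto)
    finally show ?thesis by (simp only: mult_assoc)
  qed
  consider "j = Suc i" | "j = i" | "Suc i < j" | "j < i" by linarith
  then show ?thesis
  proof cases
    case 1
    then have "descent s (Suc k) b * c * ascent s b i * s j = 1 * (descent s (Suc k) b * c * ascent s b j)"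
      using ij by (simp only: ascent_rec mult_assoc mult_1_left)
    moreover have "j \<in> {b - 1..Suc k}" using ij by auto
    ultimately show ?thesis using one_in_words[of s k] by (intro bexI)
  next
    case 2
    then obtain i' where i': "i = Suc i'" using ij by (cases i) auto
    with 2 have "descent s (Suc k) b * c * ascent s b i * s j
        = descent s (Suc k) b * c * ascent s b i' * (s i * s i)"
      using ij by (simp only: ascent_rec mult_assoc)
    also have "\<dots> = 1 * (descent s (Suc k) b * c * ascent s b i')"
      using 2 ij inv by simp
    finally have "descent s (Suc k) b * c * ascent s b i * s j = 1 * (descent s (Suc k) b * c * ascent s b i')" .
    moreover have "i' \<in> {b - 1..Suc k}" using ij 2 i' by auto
    ultimately show ?thesis using one_in_words by blast
  next
    case 3
    then have "ascent s b i * s j = s j * ascent s b i"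
      using ij by (intro ascent_commute comm) auto
    then have "descent s (Suc k) b * c * ascent s b i * s j = descent s (Suc k) b * c * s j * ascent s b i"
      by (simp only: mult_assoc)
    also have "descent s (Suc k) b * c * s j = s (j - 1) * (descent s (Suc k) b * c)"
      using ij 3 by (intro pass) auto
    finally have "descent s (Suc k) b * c * ascent s b i * s j
        = s (j - 1) * (descent s (Suc k) b * c * ascent s b i)"
      by (simp only: mult_assoc)
    moreover have "s (j - 1) \<in> words s k" using 3 ij by (intro gen_in_words) auto
    moreover have "i \<in> {b - 1..Suc k}" using ij by auto
    ultimately show ?thesis by (intro bexI)
  next
    case 4
    \<comment> \<open>The index of \<open>s j\<close> rises by one in the ascent and falls back to
      \<open>j\<close> in the descent.\<close>
    have "ascent s b i * s j = s (Suc j) * ascent s b i"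
      by (intro ascent_shift[where k = "Suc k"] comm braid) (use ij 4 in auto)
    then have "descent s (Suc k) b * c * ascent s b i * s j = descent s (Suc k) b * c * s (Suc j) * ascent s b i"
      by (simp only: mult_assoc)
    also have "descent s (Suc k) b * c * s (Suc j) = s (Suc j - 1) * (descent s (Suc k) b * c)"
      using ij 4 by (intro pass) auto
    finally have "descent s (Suc k) b * c * ascent s b i * s j
        = s j * (descent s (Suc k) b * c * ascent s b i)"
      by (simp only: mult_assoc diff_Suc_1)
    moreover have "s j \<in> words s k" using 4 ij by (intro gen_in_words) auto
    moreover have "i \<in> {b - 1..Suc k}" using ij by auto
    ultimately show ?thesis by (intro bexI)
  qed
qed

text \<open>Treats the generators at the turning end, which \<open>turn_step\<close> leaves out:
  \<open>s j\<close> commutes with the ascent after its first factor, crosses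
  \<open>s b * c * s b\<close> as \<open>s j'\<close>, and commutes with the rest of the descent. In
  type B, \<open>j = j' = 1\<close>; in type D, \<open>j\<close> and \<open>j'\<close> are 1 and 2
  in some order.\<close>

lemma turn_commute:
  assumes ij: "b \<le> i" "i \<le> Suc k" and jk: "1 \<le> j'" "j' \<le> k"
    and down: "\<And>l. b < l \<Longrightarrow> l \<le> Suc k \<Longrightarrow> s l * s j' = s j' * s l"
    and up: "\<And>l. b < l \<Longrightarrow> l \<le> Suc k \<Longrightarrow> s l * s j = s j * s l"
    and turn: "s b * c * s b * s j = s j' * (s b * c * s b)"
  shows "\<exists>h\<in>words s k. \<exists>i'\<in>{b - 1..Suc k}.
    descent s (Suc k) b * c * ascent s b i * s j = h * (descent s (Suc k) b * c * ascent s b i')"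
proof -
  let ?D = "descent s (Suc k) (Suc b)" and ?A = "ascent s (Suc b) i"
  have D: "descent s (Suc k) b = ?D * s b" and A: "ascent s b i = s b * ?A"
    using ij by (auto simp: descent_rec[of b] ascent_rec_left[of b])
  have "?A * s j = s j * ?A" using ij by (intro ascent_commute up) auto
  then have "descent s (Suc k) b * c * ascent s b i * s j = ?D * (s b * c * s b * s j) * ?A"
    unfolding A D by (simp only: mult_assoc)
  also have "\<dots> = ?D * s j' * (s b * c * s b) * ?A"
    unfolding turn by (simp only: mult_assoc)
  also have "?D * s j' = s j' * ?D"
    by (intro descent_commute down) auto
  finally have "descent s (Suc k) b * c * ascent s b i * s j
      = s j' * (descent s (Suc k) b * c * ascent s b i)"
    unfolding A D by (simp only: mult_assoc)
  moreover have "s j' \<in> words s k" using jk by (intro gen_in_words) auto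
  moreover have "i \<in> {b - 1..Suc k}" using ij by auto
  ultimately show ?thesis by (intro bexI)
qed

section \<open>Finiteness in types B and D\<close>

lemma finite_words_one:
  assumes "s 1 * s 1 = 1"
  shows "finite (words s 1)"
proof -
  have "finite (words s (Suc 0))"
  proof (rule finite_words_Suc[OF finite_words_0, of "{1, s 1}"])
    fix t j assume "t \<in> {1, s 1}" "1 \<le> j" "j \<le> Suc 0"
    then have "t * s j = 1 * s 1 \<or> t * s j = 1 * 1"
      using \<open>1 \<le> j\<close> \<open>j \<le> Suc 0\<close> assms by (elim insertE emptyE) (simp_all add: le_antisym)
    then show "\<exists>h\<in>words s 0. \<exists>t'\<in>{1, s 1}. t * s j = h * t'"
      using one_in_words[of s 0] by blast
  qed auto
  then show ?thesis by simp
qed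

lemma finite_words_B:
  assumes inv: "\<And>i. 1 \<le> i \<Longrightarrow> i \<le> n \<Longrightarrow> s i * s i = 1"
    and comm: "\<And>i j. 1 \<le> i \<Longrightarrow> i + 2 \<le> j \<Longrightarrow> j \<le> n \<Longrightarrow> s i * s j = s j * s i"
    and braid: "\<And>i. 2 \<le> i \<Longrightarrow> i < n \<Longrightarrow> s i * s (Suc i) * s i = s (Suc i) * s i * s (Suc i)"
    and braid4: "2 \<le> n \<Longrightarrow> s 2 * s 1 * s 2 * s 1 = s 1 * s 2 * s 1 * s 2"
    and k: "k \<le> n"
  shows "finite (words s k)"
  using k
proof (induction k)
  case (Suc k)
  show ?case
  proof (cases "k = 0")
    case True
    then show ?thesis using finite_words_one[of s] inv[of 1] Suc.prems by simp
  next
    case False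
    let ?D = "descent s (Suc k)" and ?A = "ascent s 2"
    let ?T = "?D ` {2..Suc (Suc k)} \<union> (\<lambda>i. ?D 2 * s 1 * ?A i) ` {2 - 1..Suc k}"
    show ?thesis
    proof (rule finite_words_Suc[of s k ?T])
      show "1 \<in> ?T" by (rule UnI1, rule image_eqI[of _ _ "Suc (Suc k)"]) (auto simp: descent_empty)
      fix t j assume t: "t \<in> ?T" and j: "1 \<le> j" "j \<le> Suc k"
      from t consider i where "i \<in> {2..Suc (Suc k)}" "t = ?D i"
        | i where "i \<in> {1..Suc k}" "t = ?D 2 * s 1 * ?A i" by auto
      then show "\<exists>h\<in>words s k. \<exists>t'\<in>?T. t * s j = h * t'"
      proof cases
        case 1
        show ?thesis
        proof (cases "2 \<le> j")
          case True
          have "\<exists>h\<in>words s k. \<exists>i'\<in>{2..Suc (Suc k)}. ?D i * s j = h * ?D i'"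
            by (intro descent_step inv comm braid) (use 1 j True Suc.prems in auto)
          then show ?thesis unfolding 1 by blast
        next
          case False
          with j have [simp]: "j = 1" by simp
          \<comment> \<open>Only the full descent \<open>?D 2\<close> turns at \<open>s 1\<close>,
            with the empty ascent \<open>?A 1\<close>; shorter descents commute with
            \<open>s 1\<close>.\<close>
          show ?thesis
          proof (cases "i = 2")
            case True
            have "t * s j = 1 * (?D 2 * s 1 * ?A 1)"
              using ascent_empty[of s 1] by (simp add: True 1 numeral_2_eq_2)
            then show ?thesis using one_in_words[of s k] by fastforce
          next
            case False
            then have "?D i * s 1 = s 1 * ?D i"
              using 1 Suc.prems by (intro descent_commute comm[symmetric]) auto
            moreover have "s 1 \<in> words s k" using \<open>k \<noteq> 0\<close> by (intro gen_in_words) auto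
            moreover have "?D i \<in> ?T" using 1 by blast
            ultimately show ?thesis unfolding 1 \<open>j = 1\<close> by (intro bexI)
          qed
        qed
      next
        case 2
        show ?thesis
        proof (cases "i = 1 \<and> j = 1")
          case True
          have "t * s j = 1 * ?D 2"
            using ascent_empty[of s 1] inv[of 1] Suc.prems True
            by (simp add: 2 mult_assoc numeral_2_eq_2)
          then show ?thesis using one_in_words[of s k] by fastforce
        next
          case False
          have "\<exists>h\<in>words s k. \<exists>i'\<in>{2 - 1..Suc k}. ?D 2 * s 1 * ?A i * s j = h * (?D 2 * s 1 * ?A i')"
          proof (cases "2 \<le> j")
            case True
            show ?thesis
              by (intro turn_step inv comm braid) (use True 2 j Suc.prems in auto)
          next
            case j2: False
            with j have [simp]: "j = 1" by simp
            show ?thesis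
            proof (rule turn_commute[where j' = 1])
              show "s 2 * s 1 * s 2 * s j = s 1 * (s 2 * s 1 * s 2)"
                using braid4 \<open>k \<noteq> 0\<close> Suc.prems by (simp add: mult_assoc)
              show "s l * s 1 = s 1 * s l" if "2 < l" "l \<le> Suc k" for l
                by (rule comm[symmetric]) (use that Suc.prems in auto)
              then show "s l * s j = s j * s l" if "2 < l" "l \<le> Suc k" for l
                using that by simp
            qed (use 2 False \<open>k \<noteq> 0\<close> in auto)
          qed
          then show ?thesis unfolding 2 by blast
        qed
      qed
    qed (use Suc in auto)
  qed
qed (simp add: finite_words_0)

lemma finite_words_two:
  assumes "s 1 * s 1 = 1" "s 2 * s 2 = 1" "s 1 * s 2 = s 2 * s 1"
  shows "finite (words s 2)"
proof -
  have "finite (words s (Suc 1))"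
  proof (rule finite_words_Suc[OF finite_words_one, of s "{1, s 2}"])
    fix t j assume t: "t \<in> {1, s 2}" and j: "1 \<le> j" "j \<le> Suc 1"
    show "\<exists>h\<in>words s 1. \<exists>t'\<in>{1, s 2}. t * s j = h * t'"
    proof (cases "j = 1")
      case True
      then have "t * s j = s 1 * t" using t assms(3) by auto
      then show ?thesis using t gen_in_words[of 1 1 s] by blast
    next
      case False
      then have "j = 2" using j by simp
      then have "t * s j = 1 * s 2 \<or> t * s j = 1 * 1"
        using t assms(2) by (elim insertE emptyE) simp_all
      then show ?thesis using one_in_words[of s 1] by blast
    qed
  qed (use assms in auto)
  then show ?thesis by (simp add: numeral_2_eq_2)
qed

text \<open>Node 3 is joined to both 1 and 2, so the condition \<open>4 \<le> j\<close> keeps the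
  pair 1, 3 out of the commutation hypothesis. The induction starts with the two commuting
  involutions \<open>s 1\<close> and \<open>s 2\<close>.\<close>

lemma finite_words_D:
  assumes inv: "\<And>i. 1 \<le> i \<Longrightarrow> i \<le> n \<Longrightarrow> s i * s i = 1"
    and comm: "\<And>i j. 1 \<le> i \<Longrightarrow> i + 2 \<le> j \<Longrightarrow> 4 \<le> j \<Longrightarrow> j \<le> n \<Longrightarrow> s i * s j = s j * s i"
    and comm12: "s 1 * s 2 = s 2 * s 1"
    and braid: "\<And>i. 3 \<le> i \<Longrightarrow> i < n \<Longrightarrow> s i * s (Suc i) * s i = s (Suc i) * s i * s (Suc i)"
    and braid13: "s 1 * s 3 * s 1 = s 3 * s 1 * s 3"
    and braid23: "s 2 * s 3 * s 2 = s 3 * s 2 * s 3"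
    and k: "2 \<le> k" "k \<le> n"
  shows "finite (words s k)"
  using k
proof (induction k rule: dec_induct)
  case base
  then show ?case using inv comm12 k by (intro finite_words_two) auto
next
  case (step k)
  let ?D = "descent s (Suc k)" and ?A = "ascent s 3" and ?c = "s 1 * s 2"
  \<comment> \<open>The diagram forks at 3: between the descents and the turned products lie the two
    products that end in just one of \<open>s 1\<close> and \<open>s 2\<close>.\<close>
  let ?T = "?D ` {3..Suc (Suc k)} \<union> {?D 3 * s 1, ?D 3 * s 2} \<union>
    (\<lambda>i. ?D 3 * ?c * ?A i) ` {3 - 1..Suc k}"
  have A2: "?A 2 = 1" using ascent_empty[of s 2] by simp
  have D3: "?D 3 = ?D 4 * s 3" using descent_rec[of 3 "Suc k" s] step.hyps by simp
  have c_mult: "?c * s j = s (3 - j)" if "j = 1 \<or> j = 2" for j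
  proof -
    have "s 1 * s 2 * s 2 = s 1" using inv[of 2] k by (simp add: mult_assoc)
    moreover have "s 1 * s 2 * s 1 = s 2"
      using inv[of 1] k unfolding comm12 by (simp add: mult_assoc)
    ultimately show ?thesis using that by auto
  qed
  \<comment> \<open>Crossing \<open>s 3 * ?c * s 3\<close> exchanges \<open>s 1\<close> and
    \<open>s 2\<close>, by their braid relations with \<open>s 3\<close>; \<open>3 - j\<close> is
    the other index.\<close>
  have turn: "s 3 * ?c * s 3 * s j = s (3 - j) * (s 3 * ?c * s 3)" if "j = 1 \<or> j = 2" for j
    using that
  proof
    assume [simp]: "j = 1"
    have "s 3 * ?c * s 3 * s 1 = s 3 * s 2 * (s 1 * s 3 * s 1)"
      by (simp only: comm12 mult_assoc)
    also have "\<dots> = (s 3 * s 2 * s 3) * (s 1 * s 3)" unfolding braid13 by (simp only: mult_assoc)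
    also have "\<dots> = s 2 * s 3 * (s 2 * s 1) * s 3" unfolding braid23[symmetric] by (simp only: mult_assoc)
    finally show ?thesis unfolding comm12[symmetric] by (simp add: mult_assoc)
  next
    assume [simp]: "j = 2"
    have "s 3 * ?c * s 3 * s 2 = s 3 * s 1 * (s 2 * s 3 * s 2)"
      by (simp only: mult_assoc)
    also have "\<dots> = (s 3 * s 1 * s 3) * (s 2 * s 3)" unfolding braid23 by (simp only: mult_assoc)
    also have "\<dots> = s 1 * s 3 * (s 1 * s 2) * s 3" unfolding braid13[symmetric] by (simp only: mult_assoc)
    finally show ?thesis by (simp add: mult_assoc)
  qed
  show ?case
  proof (rule finite_words_Suc[of s k ?T])
    show "1 \<in> ?T" using step.hyps
      by (intro UnI1, intro image_eqI[of _ _ "Suc (Suc k)"]) (auto simp: descent_empty)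
    fix t j assume t: "t \<in> ?T" and j: "1 \<le> j" "j \<le> Suc k"
    from t consider i where "i \<in> {3..Suc (Suc k)}" "t = ?D i"
      | e where "e = 1 \<or> e = 2" "t = ?D 3 * s e"
      | i where "i \<in> {2..Suc k}" "t = ?D 3 * ?c * ?A i" by auto
    then show "\<exists>h\<in>words s k. \<exists>t'\<in>?T. t * s j = h * t'"
    proof cases
      case 1
      show ?thesis
      proof (cases "3 \<le> j")
        case True
        have "\<exists>h\<in>words s k. \<exists>i'\<in>{3..Suc (Suc k)}. ?D i * s j = h * ?D i'"
          by (intro descent_step inv comm braid) (use 1 j True step.prems in auto)
        then show ?thesis unfolding 1 by blast
      next
        case False
        with j have j12: "j = 1 \<or> j = 2" by linarith
        show ?thesis
        proof (cases "i = 3")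
          case True
          then have "t * s j = 1 * (?D 3 * s j)" by (simp add: 1)
          moreover have "?D 3 * s j \<in> ?T" using j12 by blast
          ultimately show ?thesis using one_in_words[of s k] by (intro bexI)
        next
          case False
          then have "?D i * s j = s j * ?D i"
            using 1 step.prems j12 by (intro descent_commute comm[symmetric]) auto
          moreover have "s j \<in> words s k" using j12 step.hyps by (intro gen_in_words) auto
          moreover have "?D i \<in> ?T" using 1 by blast
          ultimately show ?thesis unfolding 1 by (intro bexI)
        qed
      qed
    next
      case 2
      consider "4 \<le> j" | "j = 3" | "j = e" | "j = 3 - e" using 2 j by linarith
      then show ?thesis
      proof cases
        case A: 1
        have "t * s j = ?D 3 * s j * s e"
          using 2 A j step.prems comm[of e j] by (auto simp: mult_assoc)
        also have "?D 3 * s j = s (j - 1) * ?D 3"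
          by (intro descent_shift[where b = 3] comm braid) (use A j step.prems in auto)
        finally have "t * s j = s (j - 1) * t" by (simp only: 2 mult_assoc)
        moreover have "s (j - 1) \<in> words s k" using A j by (intro gen_in_words) auto
        ultimately show ?thesis using t by (intro bexI)
      next
        case A: 2
        have "t * s j = ?D 4 * (s 3 * s e * s 3)"
          by (simp add: 2 A D3 mult_assoc)
        also have "s 3 * s e * s 3 = s e * s 3 * s e" using 2 braid13 braid23 by auto
        also have "?D 4 * (s e * s 3 * s e) = ?D 4 * s e * (s 3 * s e)" by (simp only: mult_assoc)
        also have "?D 4 * s e = s e * ?D 4"
          using 2 step.prems by (intro descent_commute comm[symmetric]) auto
        finally have "t * s j = s e * t" by (simp only: 2 D3 mult_assoc)
        moreover have "s e \<in> words s k" using 2 step.hyps by (intro gen_in_words) auto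
        ultimately show ?thesis using t by (intro bexI)
      next
        case A: 3
        have "t * s j = 1 * ?D 3" using 2 A inv[of e] k by (auto simp: mult_assoc)
        moreover have "?D 3 \<in> ?T" using step.hyps by auto
        ultimately show ?thesis using one_in_words[of s k] by (intro bexI)
      next
        case A: 4
        have "s e * s j = ?c" using 2 A comm12 by auto
        then have "t * s j = 1 * (?D 3 * ?c * ?A 2)" by (simp add: 2 A2 mult_assoc)
        moreover have "?D 3 * ?c * ?A 2 \<in> ?T" using step.hyps
          by (intro UnI2 imageI) auto
        ultimately show ?thesis using one_in_words[of s k] by (intro bexI)
      qed
    next
      case 3
      show ?thesis
      proof (cases "i = 2 \<and> j < 3")
        case True
        then have j12: "j = 1 \<or> j = 2" using j by linarith
        have "t * s j = 1 * (?D 3 * (?c * s j))" using True by (simp add: 3 A2 mult_assoc)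
        then have "t * s j = 1 * (?D 3 * s (3 - j))" by (simp only: c_mult[OF j12])
        moreover have "?D 3 * s (3 - j) \<in> ?T" using j12 by auto
        ultimately show ?thesis using one_in_words[of s k] by (intro bexI)
      next
        case False
        have "\<exists>h\<in>words s k. \<exists>i'\<in>{3 - 1..Suc k}. ?D 3 * ?c * ?A i * s j = h * (?D 3 * ?c * ?A i')"
        proof (cases "3 \<le> j")
          case True
          have "?c * s l = s l * ?c" if "3 < l" "l \<le> Suc k" for l
          proof -
            have "?c * s l = s 1 * (s l * s 2)"
              using that step.prems comm[of 2 l] by (simp add: mult_assoc)
            also have "\<dots> = (s l * s 1) * s 2"
              using that step.prems comm[of 1 l] by (simp add: mult_assoc[symmetric])
            finally show ?thesis by (simp only: mult_assoc)
          qed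
          then show ?thesis
            by (intro turn_step inv comm braid) (use 3 j True step.prems in auto)
        next
          case j3: False
          with j have j12: "j = 1 \<or> j = 2" by linarith
          show ?thesis
          proof (rule turn_commute[where j' = "3 - j"])
            show "s 3 * ?c * s 3 * s j = s (3 - j) * (s 3 * ?c * s 3)" by (rule turn[OF j12])
            show "s l * s (3 - j) = s (3 - j) * s l" if "3 < l" "l \<le> Suc k" for l
              using that j12 step.prems comm[of "3 - j" l] by auto
            show "s l * s j = s j * s l" if "3 < l" "l \<le> Suc k" for l
              using that j12 step.prems comm[of j l] by auto
          qed (use 3 False j12 step.hyps in auto)
        qed
        then show ?thesis unfolding 3 by blast
      qed
    qed
  qed (use step in auto)
qed

end

section \<open>Permutations and sensitivity\<close>

lemma sum_eq_0_involution:
  fixes g :: "'a \<Rightarrow> int"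
  assumes "\<And>x. x \<in> A \<Longrightarrow> f x \<in> A" "\<And>x. x \<in> A \<Longrightarrow> f (f x) = x"
    and "\<And>x. x \<in> A \<Longrightarrow> g (f x) = - g x"
  shows "sum g A = 0"
proof -
  have "bij_betw f A A" by (rule bij_betw_byWitness[where f' = f]) (use assms in auto)
  then have "sum g A = (\<Sum>x\<in>A. g (f x))" by (rule sum.reindex_bij_betw[symmetric])
  also have "\<dots> = - sum g A" using assms(3) by (simp add: sum_negf)
  finally show ?thesis by simp
qed

text \<open>Every other number compares with \<open>a\<close> as it does with \<open>Suc a\<close>,
  so only the order between these two can change.\<close>

lemma adjacent_transpose_less_iff:
  fixes a u v :: nat
  assumes "{u, v} \<noteq> {a, Suc a}"
  shows "transpose a (Suc a) u < transpose a (Suc a) v \<longleftrightarrow> u < v"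
  using assms unfolding transpose_def by (auto simp: doubleton_eq_iff)

text \<open>Such a permutation moves pairs as blocks and keeps the order inside each, and swapping
  two blocks takes two transpositions. The induction composes with such an even swap
  \<open>t\<close> to fix the last block.\<close>

lemma sign_pair_permutation:
  assumes "p permutes {..<2 * m}"
    and "\<And>c. c < m \<Longrightarrow> \<exists>i<m. p (2 * i) = 2 * c \<and> p (Suc (2 * i)) = Suc (2 * c)"
  shows "sign p = 1"
  using assms
proof (induction m arbitrary: p)
  case 0
  then show ?case by simp
next
  case (Suc m)
  then obtain i where i: "i < Suc m" "p (2 * i) = 2 * m" "p (Suc (2 * i)) = Suc (2 * m)" by blast
  define t where "t = transpose (2 * i) (2 * m) \<circ> transpose (Suc (2 * i)) (Suc (2 * m))"
  have t: "t permutes {..<2 * Suc m}"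
    unfolding t_def using i by (intro permutes_compose permutes_swap_id) auto
  have perm: "permutation p" "permutation t"
    using Suc.prems(1) t by (auto intro: permutes_imp_permutation[OF finite_lessThan])
  have t_even: "t (2 * j) = (if j = i then 2 * m else if j = m then 2 * i else 2 * j)" for j
    unfolding t_def transpose_def o_def by simp
  have t_odd: "t (Suc (2 * j)) = (if j = i then Suc (2 * m) else if j = m then Suc (2 * i) else Suc (2 * j))" for j
    unfolding t_def transpose_def o_def by simp
  have "sign t = 1"
    unfolding t_def by (subst sign_compose) (auto simp: permutation_swap_id sign_swap_id)
  moreover have "sign (p \<circ> t) = 1"
  proof (rule Suc.IH)
    have "p \<circ> t permutes {..<2 * Suc m}" by (rule permutes_compose[OF t Suc.prems(1)])
    moreover have "(p \<circ> t) x = x" if "x \<in> {..<2 * Suc m} - {..<2 * m}" for x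
    proof -
      have "x = 2 * m \<or> x = Suc (2 * m)" using that by auto
      then show ?thesis using i t_even[of m] t_odd[of m] by auto
    qed
    ultimately show "p \<circ> t permutes {..<2 * m}" by (rule permutes_superset) 
    fix c assume c: "c < m"
    then obtain j where j: "j < Suc m" "p (2 * j) = 2 * c" "p (Suc (2 * j)) = Suc (2 * c)"
      using Suc.prems(2)[of c] by auto
    have "j \<noteq> i" using j i c by auto
    show "\<exists>i<m. (p \<circ> t) (2 * i) = 2 * c \<and> (p \<circ> t) (Suc (2 * i)) = Suc (2 * c)"
    proof (cases "j = m")
      case True
      then show ?thesis using j i \<open>j \<noteq> i\<close> by (intro exI[of _ i]) (auto simp: t_even t_odd)
    next
      case False
      then show ?thesis using j \<open>j \<noteq> i\<close> by (intro exI[of _ j]) (auto simp: t_even t_odd)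
    qed
  qed
  ultimately show ?case using sign_compose[OF perm] by simp
qed

text \<open>Block \<open>q\<close> consists of the \<open>i < m\<close> with
  \<open>i div k = q\<close>; \<open>q * k < m\<close> says that it is nonempty. The last block may
  be shorter than \<open>k\<close>.\<close>

definition and_of_ors :: "nat \<Rightarrow> nat \<Rightarrow> (nat \<Rightarrow> bool) \<Rightarrow> bool" where
  "and_of_ors k m b \<longleftrightarrow> (\<forall>q. q * k < m \<longrightarrow> (\<exists>i<m. i div k = q \<and> b i))"

lemma and_of_ors_cong: "(\<And>i. i < m \<Longrightarrow> b i = b' i) \<Longrightarrow> and_of_ors k m b = and_of_ors k m b'"
  unfolding and_of_ors_def by metis

text \<open>If the value is true, a sensitive bit is the only true bit of its block, so each of the
  at most \<open>k\<close> blocks has at most one. If it is false, all sensitive bits lie in one and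
  the same false block, which has at most \<open>k\<close> elements.\<close>

lemma and_of_ors_sensitivity:
  assumes "m \<le> k * k"
  shows "card {i. i < m \<and> and_of_ors k m (b(i := \<not> b i)) \<noteq> and_of_ors k m b} \<le> k"
    (is "card ?S \<le> k")
proof (cases "m = 0")
  case False
  then have k: "0 < k" using assms by (cases k) auto
  show ?thesis
  proof (cases "and_of_ors k m b")
    case True
    have only: "i = j" if ij: "i \<in> ?S" "j < m" "b j" "j div k = i div k" for i j
    proof (rule ccontr)
      assume "i \<noteq> j"
      have "and_of_ors k m (b(i := \<not> b i))"
        unfolding and_of_ors_def
      proof (intro allI impI)
        fix q assume q: "q * k < m"
        show "\<exists>l<m. l div k = q \<and> (b(i := \<not> b i)) l"
        proof (cases "q = i div k")
          case True
          then show ?thesis using ij \<open>i \<noteq> j\<close> by (intro exI[of _ j]) auto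
        next
          case False
          with q \<open>and_of_ors k m b\<close> obtain l where "l < m" "l div k = q" "b l"
            unfolding and_of_ors_def by blast
          then show ?thesis using False by (intro exI[of _ l]) auto
        qed
      qed
      with ij True show False by simp
    qed
    have "inj_on (\<lambda>i. i div k) ?S"
    proof (rule inj_onI)
      fix i j assume ij: "i \<in> ?S" "j \<in> ?S" "i div k = j div k"
      have "i div k * k \<le> i" by (rule div_times_less_eq_dividend)
      with ij(1) True obtain l where l: "l < m" "l div k = i div k" "b l"
        unfolding and_of_ors_def[of k m b] by (metis (lifting) le_less_trans mem_Collect_eq)
      then show "i = j" using only[OF ij(1)] only[OF ij(2)] ij(3) by metis
    qed
    moreover have "(\<lambda>i. i div k) ` ?S \<subseteq> {..<k}"
      using assms k by (auto simp: less_mult_imp_div_less)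
    ultimately show ?thesis using card_inj_on_le[of "\<lambda>i. i div k" ?S "{..<k}"] by simp
  next
    case False
    then obtain q where q: "q * k < m" "\<And>i. i < m \<Longrightarrow> i div k = q \<Longrightarrow> \<not> b i"
      unfolding and_of_ors_def by blast
    have "?S \<subseteq> {q * k..<q * k + k}"
    proof
      fix i assume "i \<in> ?S"
      then have "and_of_ors k m (b(i := \<not> b i))" using False by simp
      with q(1) obtain l where "l < m" "l div k = q" "(b(i := \<not> b i)) l"
        unfolding and_of_ors_def by blast
      then have "i div k = q" using q(2) by (auto split: if_splits)
      then show "i \<in> {q * k..<q * k + k}"
        using k dividend_less_div_times[of k i] by (auto simp: mult.commute)
    qed
    then have "card ?S \<le> card {q * k..<q * k + k}" by (intro card_mono) auto
    then show ?thesis by simp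
  qed
qed simp

section \<open>Cayley graphs with a permutation antirepresentation\<close>

text \<open>What types B and D share. As \<open>P\<close> is an antihomomorphism, right
  multiplication acts on the values of \<open>P x\<close> and left multiplication on the positions.
  The points \<open>n\<close> and \<open>Suc n\<close> make room for the image of \<open>s 1\<close>
  in type B.\<close>

locale permutation_cayley = group G for G :: "('a, 'b) monoid_scheme" (structure) +
  fixes s :: "nat \<Rightarrow> 'a" and n :: nat and P :: "'a \<Rightarrow> nat \<Rightarrow> nat"
  assumes finite_carrier: "finite (carrier G)"
    and two_le_n: "2 \<le> n"
    and gen_closed: "1 \<le> i \<Longrightarrow> i \<le> n \<Longrightarrow> s i \<in> carrier G"
    and gen_square: "1 \<le> i \<Longrightarrow> i \<le> n \<Longrightarrow> s i \<otimes> s i = \<one>"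
    and gen_commute: "2 \<le> i \<Longrightarrow> i + 2 \<le> j \<Longrightarrow> j \<le> n \<Longrightarrow> s i \<otimes> s j = s j \<otimes> s i"
    and P_permutes: "x \<in> carrier G \<Longrightarrow> P x permutes {..Suc n}"
    and P_less: "x \<in> carrier G \<Longrightarrow> i < n \<Longrightarrow> P x i < n"
    and P_mult: "x \<in> carrier G \<Longrightarrow> y \<in> carrier G \<Longrightarrow> P (x \<otimes> y) = P y \<circ> P x"
    and P_gen: "2 \<le> i \<Longrightarrow> i \<le> n \<Longrightarrow> P (s i) = transpose (i - 2) (i - 1)"
    and sign_P_gen_1: "sign (P (s 1)) = - 1"
begin

definition parity :: "'a \<Rightarrow> int" where
  "parity x = sign (P x)"

definition pairs :: nat where
  "pairs = n div 2"

definition inverted :: "'a \<Rightarrow> nat \<Rightarrow> bool" where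
  "inverted x i \<longleftrightarrow> P x (Suc (2 * i)) < P x (2 * i)"

definition pair_image :: "'a \<Rightarrow> nat \<Rightarrow> bool" where
  "pair_image x c \<longleftrightarrow> (\<exists>i<pairs. {P x (2 * i), P x (Suc (2 * i))} = {2 * c, Suc (2 * c)})"

text \<open>\<open>k dvd i\<close> marks the leading bit of a block, which is negated. In type B,
  left multiplication by \<open>s 1\<close> exchanges \<open>P x n = n\<close> with
  \<open>P x n = Suc n\<close>, keeps all bits and reverses the sign, so without the first condition
  the signed count would vanish.\<close>

definition good :: "nat \<Rightarrow> 'a \<Rightarrow> bool" where
  "good k x \<longleftrightarrow> P x n = n \<and> and_of_ors k pairs (\<lambda>i. inverted x i \<noteq> (k dvd i))"

lemma pairs_less: "i < pairs \<Longrightarrow> Suc (2 * i) < n"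
  unfolding pairs_def by linarith

lemma pair_gen: "c < pairs \<Longrightarrow> 2 \<le> 2 * c + 2 \<and> 2 * c + 2 \<le> n"
  using pairs_less[of c] by simp

lemma P_pair_gen: "c < pairs \<Longrightarrow> P (s (2 * c + 2)) = transpose (2 * c) (Suc (2 * c))"
  using P_gen pair_gen[of c] by simp

lemma gen_closed_2: "2 \<le> j \<Longrightarrow> j \<le> n \<Longrightarrow> s j \<in> carrier G"
  using gen_closed by simp

lemma permutation_P: "x \<in> carrier G \<Longrightarrow> permutation (P x)"
  using P_permutes permutes_imp_permutation by blast

lemma P_eq_iff: "x \<in> carrier G \<Longrightarrow> P x i = P x j \<longleftrightarrow> i = j"
  using P_permutes permutes_inj by (metis injD)

lemma P_one: "P \<one> = id"
proof
  fix i
  have "P \<one> (P \<one> i) = P \<one> i"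
    using P_mult[of \<one> \<one>] by (metis comp_apply l_one one_closed)
  then show "P \<one> i = id i" by (simp add: P_eq_iff)
qed

lemma parity_cases: "parity x = 1 \<or> parity x = - 1"
  unfolding parity_def by (metis sign_cases)

lemma parity_mult: "x \<in> carrier G \<Longrightarrow> y \<in> carrier G \<Longrightarrow> parity (x \<otimes> y) = parity x * parity y"
  unfolding parity_def by (simp add: P_mult sign_compose permutation_P mult.commute)

lemma parity_gen:
  assumes "1 \<le> j" "j \<le> n"
  shows "parity (s j) = - 1"
proof (cases "j = 1")
  case False
  then show ?thesis using assms by (simp add: parity_def P_gen sign_swap_id)
qed (simp add: parity_def sign_P_gen_1[unfolded One_nat_def])

lemma parity_mult_gen:
  "x \<in> carrier G \<Longrightarrow> 1 \<le> j \<Longrightarrow> j \<le> n \<Longrightarrow> parity (x \<otimes> s j) = - parity x"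
  "x \<in> carrier G \<Longrightarrow> 1 \<le> j \<Longrightarrow> j \<le> n \<Longrightarrow> parity (s j \<otimes> x) = - parity x"
  by (simp_all add: parity_mult parity_gen gen_closed)

lemma mult_gen_gen: "x \<in> carrier G \<Longrightarrow> 1 \<le> j \<Longrightarrow> j \<le> n \<Longrightarrow> x \<otimes> s j \<otimes> s j = x"
  by (simp add: m_assoc gen_closed gen_square)

lemma gen_gen_mult: "x \<in> carrier G \<Longrightarrow> 1 \<le> j \<Longrightarrow> j \<le> n \<Longrightarrow> s j \<otimes> (s j \<otimes> x) = x"
  by (simp add: m_assoc[symmetric] gen_closed gen_square)

lemma P_mult_gen:
  assumes "x \<in> carrier G" "2 \<le> j" "j \<le> n"
  shows "P (x \<otimes> s j) i = transpose (j - 2) (Suc (j - 2)) (P x i)"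
proof -
  have "j - 1 = Suc (j - 2)" using assms by simp
  then show ?thesis using assms by (simp add: P_mult gen_closed_2 P_gen)
qed

lemma P_mult_gen_n:
  assumes "x \<in> carrier G" "2 \<le> j" "j \<le> n"
  shows "P (x \<otimes> s j) n = n \<longleftrightarrow> P x n = n"
  using assms by (auto simp: P_mult_gen transpose_def)

text \<open>The swap of the values \<open>j - 2\<close> and \<open>j - 1\<close> alters an order
  only between positions that carry exactly these two.\<close>

lemma inverted_mult_gen:
  assumes "x \<in> carrier G" "2 \<le> j" "j \<le> n"
    and "{P x (2 * i), P x (Suc (2 * i))} \<noteq> {j - 2, Suc (j - 2)}"
  shows "inverted (x \<otimes> s j) i = inverted x i"
  using assms adjacent_transpose_less_iff[of "P x (Suc (2 * i))" "P x (2 * i)" "j - 2"]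
  by (simp add: inverted_def P_mult_gen insert_commute)

text \<open>Left multiplication swaps the positions \<open>2 * f\<close> and
  \<open>Suc (2 * f)\<close>, which reverses this pair and leaves the others in place.\<close>

lemma inverted_gen_mult:
  assumes x: "x \<in> carrier G" and f: "f < pairs"
  shows "inverted (s (2 * f + 2) \<otimes> x) i = (inverted x i \<noteq> (i = f))"
proof -
  have P: "P (s (2 * f + 2) \<otimes> x) j = P x (transpose (2 * f) (Suc (2 * f)) j)" for j
    using x pair_gen[OF f] by (simp add: P_mult gen_closed_2 P_pair_gen[OF f, simplified])
  show ?thesis
  proof (cases "i = f")
    case True
    have "P x (2 * f) \<noteq> P x (Suc (2 * f))" using x by (simp add: P_eq_iff)
    then show ?thesis unfolding inverted_def P True by auto
  next
    case False
    then have "transpose (2 * f) (Suc (2 * f)) (2 * i) = 2 * i"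
      "transpose (2 * f) (Suc (2 * f)) (Suc (2 * i)) = Suc (2 * i)"
      by (auto simp: transpose_def)
    then show ?thesis unfolding inverted_def P by (simp add: False)
  qed
qed

section \<open>The signed count of the good elements\<close>

text \<open>
  Swapping the values \<open>2 c\<close> and \<open>2 c + 1\<close>, for the least \<open>c\<close> such that these are not the image of a
  pair, changes no inversion bit.
\<close>

lemma sum_good_not_all_pair_image:
  "(\<Sum>x | x \<in> carrier G \<and> good k x \<and> \<not> (\<forall>c<pairs. pair_image x c). parity x) = 0"
proof -
  define c where "c x = (LEAST c. c < pairs \<and> \<not> pair_image x c)" for x
  have c: "c x < pairs" "\<not> pair_image x (c x)" if "\<not> (\<forall>c<pairs. pair_image x c)" for x
    using that LeastI_ex[of "\<lambda>c. c < pairs \<and> \<not> pair_image x c"] unfolding c_def by auto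
  define f where "f x = x \<otimes> s (2 * c x + 2)" for x
  have f: "f x \<in> carrier G \<and> good k (f x) \<and> \<not> (\<forall>c<pairs. pair_image (f x) c) \<and> c (f x) = c x"
    if x: "x \<in> carrier G" "good k x" "\<not> (\<forall>c<pairs. pair_image x c)" for x
  proof -
    let ?t = "transpose (2 * c x) (Suc (2 * c x))"
    note cx = c[OF x(3)]
    have j: "2 \<le> 2 * c x + 2" "2 * c x + 2 \<le> n" using pair_gen[OF cx(1)] by auto
    have P: "P (f x) i = ?t (P x i)" for i
      using P_mult_gen[OF x(1) j] by (simp add: f_def)
    \<comment> \<open>No pair of positions carries exactly the two swapped values, since
      \<open>c x\<close> is not the image of a pair.\<close>
    have "inverted (f x) i = inverted x i" if "i < pairs" for i
      unfolding f_def using x(1) j cx that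
      by (intro inverted_mult_gen) (auto simp: pair_image_def)
    then have "and_of_ors k pairs (\<lambda>i. inverted (f x) i \<noteq> (k dvd i))
        = and_of_ors k pairs (\<lambda>i. inverted x i \<noteq> (k dvd i))"
      by (intro and_of_ors_cong) simp
    then have "good k (f x)"
      using x(2) P_mult_gen_n[OF x(1) j] by (simp add: good_def f_def)
    moreover have "f x \<in> carrier G" using x(1) j by (simp add: f_def gen_closed_2)
    \<comment> \<open>The swapped values form one block, so every block
      \<open>{2 * d, Suc (2 * d)}\<close> is mapped to itself. Hence \<open>c\<close> is unchanged,
      which makes \<open>f\<close> an involution.\<close>
    moreover have pi: "pair_image (f x) d = pair_image x d" for d
    proof -
      have t: "?t ` {2 * d, Suc (2 * d)} = {2 * d, Suc (2 * d)}"
      proof (cases "d = c x")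
        case False
        then have "2 * d \<noteq> Suc (2 * c x)" "Suc (2 * d) \<noteq> 2 * c x" by presburger+
        with False show ?thesis by (simp add: transpose_def)
      qed auto
      have "{P (f x) (2 * i), P (f x) (Suc (2 * i))} = {2 * d, Suc (2 * d)}
          \<longleftrightarrow> ?t ` {P x (2 * i), P x (Suc (2 * i))} = ?t ` {2 * d, Suc (2 * d)}" for i
        unfolding t by (simp add: P)
      also have "\<dots> i \<longleftrightarrow> {P x (2 * i), P x (Suc (2 * i))} = {2 * d, Suc (2 * d)}" for i
        by (rule inj_image_eq_iff[OF inj_transpose])
      finally show ?thesis unfolding pair_image_def by simp
    qed
    moreover have "c (f x) = c x" unfolding c_def pi ..
    ultimately show ?thesis using x(3) by simp
  qed
  show ?thesis
  proof (rule sum_eq_0_involution[where f = f])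
    fix x assume "x \<in> {x \<in> carrier G. good k x \<and> \<not> (\<forall>c<pairs. pair_image x c)}"
    then have x: "x \<in> carrier G" "good k x" "\<not> (\<forall>c<pairs. pair_image x c)" by auto
    have j: "1 \<le> 2 * c x + 2" "2 * c x + 2 \<le> n" using pair_gen[OF c(1)[OF x(3)]] by auto
    show "f x \<in> {x \<in> carrier G. good k x \<and> \<not> (\<forall>c<pairs. pair_image x c)}"
      using f[OF x] by blast
    have "f (f x) = f x \<otimes> s (2 * c x + 2)" using f[OF x] by (simp add: f_def[of "f x"])
    then show "f (f x) = x" using mult_gen_gen[OF x(1) j] by (simp add: f_def)
    show "parity (f x) = - parity x"
      using parity_mult_gen(1)[OF x(1) j] by (simp add: f_def)
  qed
qed

text \<open>
  In the first block with an inverted bit besides its leading one, the value of the leading bit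
  does not matter, and left multiplication by a generator flips it.
\<close>

lemma sum_good_inverted:
  assumes k: "0 < k"
  shows "(\<Sum>x | x \<in> carrier G \<and> good k x \<and> (\<forall>c<pairs. pair_image x c) \<and> (\<exists>i<pairs. inverted x i).
    parity x) = 0"
proof -
  define h where "h x q \<longleftrightarrow> (\<exists>i<pairs. i div k = q \<and> \<not> k dvd i \<and> inverted x i)" for x q
  define q where "q x = (LEAST q. h x q)" for x
  let ?B = "\<lambda>x. x \<in> carrier G \<and> good k x \<and> (\<forall>c<pairs. pair_image x c) \<and> (\<exists>i<pairs. inverted x i)"
  have hq: "h x (q x)" if x: "?B x" for x
  proof -
    from x obtain i where i: "i < pairs" "inverted x i" by blast
    \<comment> \<open>An inverted leading bit enters the OR as false, so a good \<open>x\<close> has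
      another true bit in that block; it is not leading, hence inverted.\<close>
    have "h x (i div k)"
    proof (cases "k dvd i")
      case True
      then have "i div k * k < pairs" using i by simp
      then obtain l where l: "l < pairs" "l div k = i div k" "inverted x l \<noteq> (k dvd l)"
        using x unfolding good_def and_of_ors_def by blast
      have "\<not> k dvd l"
      proof
        assume "k dvd l"
        then have "l = i" using True l(2) by (metis dvd_div_mult_self)
        then show False using l(3) i True by simp
      qed
      then show ?thesis using l by (auto simp: h_def)
    qed (use i in \<open>auto simp: h_def\<close>)
    then show ?thesis unfolding q_def by (rule LeastI)
  qed
  have qless: "q x * k < pairs" if "?B x" for x
  proof -
    from hq[OF that] obtain i where "i < pairs" "i div k = q x" unfolding h_def by blast
    then show ?thesis using div_times_less_eq_dividend[of i k] by simp
  qed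
  define f where "f x = s (2 * (q x * k) + 2) \<otimes> x" for x
  have f: "?B (f x) \<and> q (f x) = q x" if x: "?B x" for x
  proof -
    let ?t = "transpose (2 * (q x * k)) (Suc (2 * (q x * k)))"
    have xc: "x \<in> carrier G" using x by simp
    have j: "2 \<le> 2 * (q x * k) + 2" "2 * (q x * k) + 2 \<le> n" using pair_gen[OF qless[OF x]] by auto
    have P: "P (f x) i = P x (?t i)" for i
      using xc j by (simp add: f_def P_mult gen_closed_2 P_pair_gen[OF qless[OF x], simplified])
    have inv: "inverted (f x) i = (inverted x i \<noteq> (i = q x * k))" for i
      unfolding f_def by (rule inverted_gen_mult[OF xc qless[OF x]])
    have inv': "inverted (f x) i = inverted x i" if "\<not> k dvd i" for i
      using inv[of i] that by auto
    \<comment> \<open>\<open>h\<close> sees only bits that are not leading, so \<open>f\<close>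
      preserves \<open>q\<close>.\<close>
    have h: "h (f x) r = h x r" for r
      unfolding h_def using inv' by blast
    from hq[OF x] obtain w where w: "w < pairs" "w div k = q x" "\<not> k dvd w" "inverted x w"
      unfolding h_def by blast
    have "f x \<in> carrier G" using xc j by (simp add: f_def gen_closed_2)
    moreover have "good k (f x)"
      unfolding good_def and_of_ors_def
    proof (intro conjI allI impI)
      have "?t n = n" using j by (intro transpose_apply_other) auto
      then show "P (f x) n = n" using x by (simp add: P good_def)
      fix r assume r: "r * k < pairs"
      show "\<exists>i<pairs. i div k = r \<and> inverted (f x) i \<noteq> (k dvd i)"
      \<comment> \<open>In block \<open>q x\<close> the bit \<open>w\<close> keeps the OR true; in
        the other blocks no bit changes.\<close>
      proof (cases "r = q x")
        case True
        then show ?thesis using w inv' by auto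
      next
        case False
        from x r obtain i where i: "i < pairs" "i div k = r" "inverted x i \<noteq> (k dvd i)"
          unfolding good_def and_of_ors_def by blast
        have "i \<noteq> q x * k" using i(2) False k by auto
        then show ?thesis using i inv by auto
      qed
    qed
    moreover have "pair_image (f x) c = pair_image x c" for c
    proof -
      have "{P x (?t (2 * i)), P x (?t (Suc (2 * i)))} = {P x (2 * i), P x (Suc (2 * i))}" for i
      proof (cases "i = q x * k")
        case False
        then have "2 * i \<noteq> Suc (2 * (q x * k))" "Suc (2 * i) \<noteq> 2 * (q x * k)" by presburger+
        with False show ?thesis by (simp add: transpose_def)
      qed auto
      then show ?thesis unfolding pair_image_def P by simp
    qed
    moreover have "\<exists>i<pairs. inverted (f x) i" using w inv' by blast
    moreover have "q (f x) = q x" unfolding q_def h ..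
    ultimately show ?thesis using x by simp
  qed
  show ?thesis
  proof (rule sum_eq_0_involution[where f = f])
    fix x assume "x \<in> {x. ?B x}"
    then have x: "?B x" by simp
    then have xc: "x \<in> carrier G" by simp
    have j: "1 \<le> 2 * (q x * k) + 2" "2 * (q x * k) + 2 \<le> n" using pair_gen[OF qless[OF x]] by auto
    show "f x \<in> {x. ?B x}" using f[OF x] by simp
    have "f (f x) = s (2 * (q x * k) + 2) \<otimes> f x" using f[OF x] by (simp add: f_def[of "f x"])
    then show "f (f x) = x" using gen_gen_mult[OF xc j] by (simp add: f_def)
    show "parity (f x) = - parity x" using parity_mult_gen(2)[OF xc j] by (simp add: f_def)
  qed
qed

text \<open>\<open>sign_pair_permutation\<close> applies once all other points are fixed:
  \<open>n\<close> by assumption, \<open>Suc n\<close> because the points below \<open>n\<close> are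
  permuted among themselves, and for odd \<open>n\<close> the point \<open>n - 1\<close>, the only
  one below \<open>n\<close> outside the pairs.\<close>

lemma parity_eq_1:
  assumes x: "x \<in> carrier G" "P x n = n" and pi: "\<And>c. c < pairs \<Longrightarrow> pair_image x c"
    and inv: "\<And>i. i < pairs \<Longrightarrow> \<not> inverted x i"
  shows "parity x = 1"
proof -
  have ex: "\<exists>i<pairs. P x (2 * i) = 2 * c \<and> P x (Suc (2 * i)) = Suc (2 * c)" if c: "c < pairs" for c
  proof -
    obtain i where i: "i < pairs" "{P x (2 * i), P x (Suc (2 * i))} = {2 * c, Suc (2 * c)}"
      using pi[OF c] unfolding pair_image_def by blast
    then show ?thesis using inv[OF i(1)] unfolding inverted_def doubleton_eq_iff
      by (intro exI[of _ i]) auto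
  qed
  have inj: "inj (P x)" using P_permutes[OF x(1)] by (rule permutes_inj)
  have sub: "{..<2 * pairs} \<subseteq> P x ` {..<2 * pairs}"
  proof
    fix y assume y: "y \<in> {..<2 * pairs}"
    then have "y div 2 < pairs" by auto
    from ex[OF this] obtain i where "i < pairs" "P x (2 * i) = 2 * (y div 2)"
      "P x (Suc (2 * i)) = Suc (2 * (y div 2))" by blast
    moreover have "y = 2 * (y div 2) \<or> y = Suc (2 * (y div 2))" by presburger
    ultimately have "y = P x (2 * i) \<and> 2 * i < 2 * pairs \<or> y = P x (Suc (2 * i)) \<and> Suc (2 * i) < 2 * pairs"
      by auto
    then show "y \<in> P x ` {..<2 * pairs}" by blast
  qed
  have low: "P x ` {..<2 * pairs} = {..<2 * pairs}"
    using card_seteq[OF finite_imageI[OF finite_lessThan] sub] card_image_le[of "{..<2 * pairs}" "P x"] by simp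
  have ge: "2 * pairs \<le> P x y" if "2 * pairs \<le> y" for y
  proof (rule ccontr)
    assume "\<not> ?thesis"
    then have "P x y \<in> P x ` {..<2 * pairs}" unfolding low by simp
    then show False using that by (auto simp: inj_image_mem_iff[OF inj])
  qed
  have "P x ` {..<n} = {..<n}"
    by (rule endo_inj_surj) (use P_less[OF x(1)] inj in \<open>auto intro: inj_on_subset\<close>)
  then have ge_n: "n \<le> P x (Suc n)"
    using inj_image_mem_iff[OF inj, of "Suc n" "{..<n}"] by simp
  have "P x permutes {..<2 * pairs}"
  proof (rule permutes_superset[OF P_permutes[OF x(1)]])
    fix y assume "y \<in> {..Suc n} - {..<2 * pairs}"
    then consider "y = n" | "y = Suc n" | "2 * pairs \<le> y" "y < n" by force
    then show "P x y = y"
    proof cases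
      case 2
      have "P x (Suc n) \<in> {..Suc n}"
        unfolding permutes_in_image[OF P_permutes[OF x(1)]] by simp
      moreover have "P x (Suc n) \<noteq> n" using P_eq_iff[OF x(1), of "Suc n" n] x(2) by simp
      ultimately show ?thesis using ge_n 2 by simp
    next
      case 3
      then show ?thesis using ge[of y] P_less[OF x(1), of y] unfolding pairs_def by presburger
    qed (use x(2) in simp)
  qed
  then show ?thesis unfolding parity_def using ex by (rule sign_pair_permutation)
qed

lemma sum_good_pos:
  assumes k: "0 < k"
  shows "0 < (\<Sum>x | x \<in> carrier G \<and> good k x. parity x)"
proof -
  let ?p = "\<lambda>x. \<forall>c<pairs. pair_image x c" and ?i = "\<lambda>x. \<exists>i<pairs. inverted x i"
  let ?S = "{x. x \<in> carrier G \<and> good k x}"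
  let ?A = "{x. x \<in> carrier G \<and> good k x \<and> \<not> ?p x}"
  let ?B = "{x. x \<in> carrier G \<and> good k x \<and> ?p x \<and> ?i x}"
  let ?Z = "{x. x \<in> carrier G \<and> good k x \<and> ?p x \<and> \<not> ?i x}"
  have "{x. x \<in> carrier G \<and> good k x} = {x. x \<in> carrier G \<and> good k x \<and> \<not> p x} \<union>
      ({x. x \<in> carrier G \<and> good k x \<and> p x \<and> i x} \<union>
       {x. x \<in> carrier G \<and> good k x \<and> p x \<and> \<not> i x})" for p i
    by blast
  then have "?S = ?A \<union> (?B \<union> ?Z)" .
  then have "sum parity ?S = sum parity (?A \<union> (?B \<union> ?Z))" by (rule arg_cong)
  also have "\<dots> = sum parity ?A + sum parity (?B \<union> ?Z)"
    by (rule sum.union_disjoint) (use finite_carrier in auto)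
  also have "sum parity (?B \<union> ?Z) = sum parity ?B + sum parity ?Z"
    by (rule sum.union_disjoint) (use finite_carrier in auto)
  also have "sum parity ?A + (sum parity ?B + sum parity ?Z) = sum parity ?Z"
    unfolding sum_good_not_all_pair_image sum_good_inverted[OF k] by simp
  also have "\<dots> = (\<Sum>x\<in>?Z. 1)"
    by (rule sum.cong[OF HOL.refl]) (auto intro: parity_eq_1 simp: good_def)
  finally have "sum parity ?S = int (card ?Z)" by simp
  \<comment> \<open>The identity inverts nothing, so the negated leading bits satisfy every
    block.\<close>
  moreover have "\<one> \<in> ?Z"
  proof -
    have "and_of_ors k pairs (\<lambda>i. k dvd i)"
      unfolding and_of_ors_def
    proof (intro allI impI)
      fix q assume "q * k < pairs"
      then show "\<exists>i<pairs. i div k = q \<and> k dvd i" using k by (intro exI[of _ "q * k"]) auto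
    qed
    moreover have "pair_image \<one> c" if "c < pairs" for c
      using that by (auto simp: pair_image_def P_one)
    ultimately show ?thesis by (simp add: good_def inverted_def P_one)
  qed
  then have "0 < card ?Z" using finite_carrier card_gt_0_iff[of ?Z] by auto
  ultimately show ?thesis by simp
qed

end

section \<open>Bounding the graph parameters\<close>

lemma independence_number_le:
  assumes "finite (pverts H)" and "\<And>I. independent_set H I \<Longrightarrow> card I \<le> a"
  shows "independence_number H \<le> a"
  unfolding independence_number_def
proof (rule Max.boundedI)
  have "{card I | I. independent_set H I} \<subseteq> card ` Pow (pverts H)"
    unfolding independent_set_def by blast
  then show "finite {card I | I. independent_set H I}"
    by (rule finite_subset) (simp add: assms(1))
  have "independent_set H {}" by (simp add: independent_set_def)
  then show "{card I | I. independent_set H I} \<noteq> {}" by blast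
qed (use assms(2) in auto)

lemma sigma_le:
  assumes fin: "finite (pverts H)" and K: "K \<subseteq> pverts H" "independence_number H < card K"
    and deg: "\<And>x. x \<in> K \<Longrightarrow> card {y \<in> K. (x, y) \<in> parcs H} \<le> d"
  shows "sigma H \<le> d"
proof -
  let ?M = "{max_degree (with_proj H \<restriction> K) | K. K \<subseteq> pverts H \<and> card K > independence_number H}"
  have "?M \<subseteq> (\<lambda>K. max_degree (with_proj H \<restriction> K)) ` Pow (pverts H)" by blast
  then have "finite ?M" by (rule finite_subset) (simp add: fin)
  moreover have "max_degree (with_proj H \<restriction> K) \<in> ?M" using K by blast
  ultimately have "sigma H \<le> max_degree (with_proj H \<restriction> K)"
    unfolding sigma_def by (rule Min_le)
  also have "\<dots> \<le> d"
    unfolding max_degree_def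
  proof (rule Max.boundedI)
    have vK: "verts (with_proj H \<restriction> K) = K" by simp
    show "finite (out_degree (with_proj H \<restriction> K) ` verts (with_proj H \<restriction> K))"
      unfolding vK using finite_subset[OF K(1) fin] by simp
    have "K \<noteq> {}" using K(2) by auto
    then show "out_degree (with_proj H \<restriction> K) ` verts (with_proj H \<restriction> K) \<noteq> {}" unfolding vK by simp
    fix e assume "e \<in> out_degree (with_proj H \<restriction> K) ` verts (with_proj H \<restriction> K)"
    then obtain x where x: "x \<in> K" "e = out_degree (with_proj H \<restriction> K) x" unfolding vK by blast
    have "out_arcs (with_proj H \<restriction> K) x = Pair x ` {y \<in> K. (x, y) \<in> parcs H}"
      using x(1) by (auto simp: out_arcs_def induce_subgraph_def)
    then have "e = card {y \<in> K. (x, y) \<in> parcs H}"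
      unfolding x(2) out_degree_def by (simp add: card_image inj_on_def)
    then show "e \<le> d" using deg[OF x(1)] by simp
  qed
  finally show ?thesis .
qed

text \<open>The image of the cube, with the image arcs, is a subgraph isomorphic to it. A cube of
  dimension \<open>e\<close> has \<open>2 ^ e \<ge> e\<close> vertices, so the dimensions that occur
  are bounded and \<open>Max\<close> is taken over a finite set.\<close>

lemma kappa_ge:
  fixes H :: "'a pair_pre_digraph"
  assumes fin: "finite (pverts H)" and wf: "parcs H \<subseteq> pverts H \<times> pverts H"
    and inj: "inj_on f (pverts (hypercube d))"
    and f: "f ` pverts (hypercube d) \<subseteq> pverts H"
    and arcs: "\<And>x y. (x, y) \<in> parcs (hypercube d) \<Longrightarrow> (f x, f y) \<in> parcs H"
  shows "d \<le> kappa H"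
proof -
  let ?D = "{d. \<exists>F :: 'a pair_pre_digraph.
      subgraph (with_proj F) (with_proj H) \<and> digraph_iso (with_proj (hypercube d)) (with_proj F)}"
  have wf_cube: "wf_digraph (with_proj (hypercube d))" for d
    by unfold_locales (auto simp: hypercube_def)
  have "e \<le> card (pverts H)" if "e \<in> ?D" for e
  proof -
    from that obtain F :: "'a pair_pre_digraph" and g where F: "pverts F \<subseteq> pverts H"
      and g: "inj_on (iso_verts g) (pverts (hypercube e))" "with_proj F = app_iso g (with_proj (hypercube e))"
      unfolding subgraph_def digraph_iso_def pre_digraph.digraph_isomorphism_def by auto
    have "pverts F = iso_verts g ` pverts (hypercube e)"
      using arg_cong[OF g(2), of verts] by simp
    then have "card (pverts (hypercube e)) \<le> card (pverts H)"
      using card_inj_on_le[OF g(1) _ fin] F by simp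
    moreover have "pverts (hypercube e) = {xs. set xs \<subseteq> (UNIV :: bool set) \<and> length xs = e}"
      by (simp add: hypercube_def)
    then have "card (pverts (hypercube e)) = 2 ^ e"
      using card_lists_length_eq[of "UNIV :: bool set" e] by simp
    moreover have "e \<le> 2 ^ e" by (rule less_imp_le) simp
    ultimately show ?thesis by linarith
  qed
  then have fin_D: "finite ?D" by (intro finite_subset[OF _ finite_atMost[of "card (pverts H)"]]) blast
  have "d \<in> ?D"
  proof (intro CollectI exI conjI)
    let ?F = "\<lparr>pverts = f ` pverts (hypercube d), parcs = map_prod f f ` parcs (hypercube d)\<rparr>"
    let ?g = "\<lparr>iso_verts = f, iso_arcs = map_prod f f, iso_head = snd, iso_tail = fst\<rparr>"
    show "subgraph (with_proj ?F) (with_proj H)"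
    proof (rule subgraphI)
      show "verts (with_proj ?F) \<subseteq> verts (with_proj H)" using f by simp
      show "arcs (with_proj ?F) \<subseteq> arcs (with_proj H)" using arcs by auto
      show "compatible (with_proj H) (with_proj ?F)" by (simp add: compatible_def)
      show "wf_digraph (with_proj H)" by unfold_locales (use wf in auto)
      show "wf_digraph (with_proj ?F)"
        by unfold_locales (auto simp: hypercube_def)
    qed
    have "parcs (hypercube d) \<subseteq> pverts (hypercube d) \<times> pverts (hypercube d)"
      by (auto simp: hypercube_def)
    then have "inj_on (map_prod f f) (parcs (hypercube d))"
      using inj map_prod_inj_on[OF inj inj] inj_on_subset by blast
    then have "pre_digraph.digraph_isomorphism (with_proj (hypercube d)) ?g"
      using wf_cube inj by (simp add: pre_digraph.digraph_isomorphism_def)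
    moreover have "with_proj ?F = app_iso ?g (with_proj (hypercube d))"
      by (simp add: with_proj_def app_iso_def)
    ultimately show "digraph_iso (with_proj (hypercube d)) (with_proj ?F)"
      unfolding digraph_iso_def by blast
  qed
  then show ?thesis unfolding kappa_def using fin_D by (rule Max_ge[rotated])
qed

lemma hypercube_arc_flip:
  assumes "(x, y) \<in> parcs (hypercube d)"
  shows "\<exists>i<d. y = x[i := \<not> x ! i]"
proof -
  from assms have len: "length x = d" "length y = d"
    and c: "card {i. i < d \<and> x ! i \<noteq> y ! i} = 1" by (auto simp: hypercube_def)
  from c obtain i where i: "{i. i < d \<and> x ! i \<noteq> y ! i} = {i}" by (auto simp: card_1_singleton_iff)
  have "y = x[i := \<not> x ! i]"
  proof (rule nth_equalityI)
    fix j assume "j < length y"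
    then show "y ! j = x[i := \<not> x ! i] ! j"
      using i len by (cases "j = i") (auto simp: set_eq_iff)
  qed (use len in simp)
  moreover have "i < d" using i by blast
  ultimately show ?thesis by blast
qed

section \<open>The induced subgraph on more than half of the vertices\<close>

context permutation_cayley
begin

abbreviation graph :: "'a pair_pre_digraph" where
  "graph \<equiv> cayley_graph G (s ` {1..n})"

lemma graph_arc_iff:
  "(x, y) \<in> parcs graph \<longleftrightarrow> x \<in> carrier G \<and> (\<exists>j\<in>{1..n}. y = x \<otimes> s j)"
proof -
  have "(x, y) \<in> parcs graph \<longleftrightarrow> x \<in> carrier G \<and> y \<in> carrier G \<and> (\<exists>j\<in>{1..n}. inv x \<otimes> y = s j)"
    by (auto simp: cayley_graph_def)
  also have "\<dots> \<longleftrightarrow> x \<in> carrier G \<and> (\<exists>j\<in>{1..n}. y = x \<otimes> s j)"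
  proof -
    have "inv x \<otimes> (x \<otimes> s j) = s j" if "x \<in> carrier G" "j \<in> {1..n}" for j
      using that gen_closed[of j] by (simp add: m_assoc[symmetric])
    moreover have "y = x \<otimes> (inv x \<otimes> y)" if "x \<in> carrier G" "y \<in> carrier G"
      using that by (simp add: m_assoc[symmetric])
    moreover have "x \<otimes> s j \<in> carrier G" if "x \<in> carrier G" "j \<in> {1..n}" for j
      using that gen_closed[of j] by simp
    ultimately show ?thesis by metis
  qed
  finally show ?thesis .
qed

lemma sum_parity: "sum parity (carrier G) = 0"
proof (rule sum_eq_0_involution[where f = "\<lambda>x. x \<otimes> s 2"])
  fix x assume x: "x \<in> carrier G"
  show "x \<otimes> s 2 \<in> carrier G" using x two_le_n gen_closed by simp
  show "x \<otimes> s 2 \<otimes> s 2 = x" using x two_le_n by (intro mult_gen_gen) auto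
  show "parity (x \<otimes> s 2) = - parity x" using x two_le_n by (intro parity_mult_gen) auto
qed

lemma independence_number_graph: "2 * independence_number graph \<le> card (carrier G)"
proof -
  have "independence_number graph \<le> card (carrier G) div 2"
  proof (rule independence_number_le)
    show "finite (pverts graph)" using finite_carrier by (simp add: cayley_graph_def)
    fix I assume I: "independent_set graph I"
    then have sub: "I \<subseteq> carrier G" by (simp add: independent_set_def cayley_graph_def)
    let ?r = "\<lambda>x. x \<otimes> s 2"
    have s2: "s 2 \<in> carrier G" using two_le_n gen_closed by simp
    have "inj_on ?r I" 
      by (rule inj_on_inverseI[where g = ?r]) (use sub two_le_n in \<open>auto intro!: mult_gen_gen\<close>)
    then have "card (?r ` I) = card I" by (rule card_image)
    moreover have "I \<inter> ?r ` I = {}"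
    proof -
      have "(x, x \<otimes> s 2) \<in> parcs graph" if "x \<in> I" for x
        unfolding graph_arc_iff using that sub two_le_n by auto
      then show ?thesis using I unfolding independent_set_def by blast
    qed
    moreover have fin: "finite I" using sub finite_carrier by (rule finite_subset)
    ultimately have "2 * card I = card (I \<union> ?r ` I)" by (simp add: card_Un_disjoint)
    also have "\<dots> \<le> card (carrier G)"
      using sub s2 by (intro card_mono finite_carrier) auto
    finally show "card I \<le> card (carrier G) div 2" by simp
  qed
  then show ?thesis by simp
qed

text \<open>Arcs change the parity, so adjacent members differ in \<open>good\<close>; this ties
  degrees to sensitivity.\<close>

definition large :: "nat \<Rightarrow> 'a set" where
  "large k = {x \<in> carrier G. parity x = 1 \<longleftrightarrow> good k x}"

lemma card_large:
  assumes "0 < k"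
  shows "card (carrier G) < 2 * card (large k)"
proof -
  let ?S = "{x. x \<in> carrier G \<and> good k x}"
  have "2 * int (card (large k)) = (\<Sum>x\<in>carrier G. if x \<in> large k then 2 else 0)"
    using finite_carrier by (simp add: sum.If_cases large_def Int_def)
  \<comment> \<open>The indicator of \<open>large k\<close> is \<open>(1 + parity x) / 2\<close> on
    the good elements and \<open>(1 - parity x) / 2\<close> elsewhere.\<close>
  also have "\<dots> = (\<Sum>x\<in>carrier G. 1 - parity x + 2 * (if x \<in> ?S then parity x else 0))"
  proof (rule sum.cong[OF HOL.refl])
    fix x assume "x \<in> carrier G"
    then show "(if x \<in> large k then 2 else 0) = 1 - parity x + 2 * (if x \<in> ?S then parity x else 0)"
      using parity_cases[of x] by (auto simp: large_def)
  qed
  also have "\<dots> = int (card (carrier G)) - sum parity (carrier G) + 2 * (\<Sum>x\<in>carrier G. if x \<in> ?S then parity x else 0)"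
    by (simp add: sum.distrib sum_subtractf sum_distrib_left)
  also have "(\<Sum>x\<in>carrier G. if x \<in> ?S then parity x else 0) = sum parity ?S"
    using finite_carrier by (simp add: sum.inter_filter)
  finally show ?thesis using sum_good_pos[OF assms] by (simp add: sum_parity)
qed

text \<open>For \<open>2 \<le> j\<close> the condition \<open>P x n = n\<close> is unaffected, so a
  generator that changes \<open>good\<close> flips a bit. It flips only one, this bit is sensitive,
  and it determines the generator.\<close>

lemma card_good_change:
  assumes x: "x \<in> carrier G" and k: "pairs \<le> k * k"
  shows "card {j \<in> {2..n}. good k (x \<otimes> s j) \<noteq> good k x} \<le> k"
proof -
  define b where "b i \<longleftrightarrow> inverted x i \<noteq> (k dvd i)" for i
  let ?J = "{j \<in> {2..n}. good k (x \<otimes> s j) \<noteq> good k x}"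
  let ?S = "{i. i < pairs \<and> and_of_ors k pairs (b(i := \<not> b i)) \<noteq> and_of_ors k pairs b}"
  \<comment> \<open>the only generator besides \<open>s 1\<close> that can change bit \<open>i\<close>\<close>
  let ?g = "\<lambda>i. min (P x (2 * i)) (P x (Suc (2 * i))) + 2"
  have "?J \<subseteq> ?g ` ?S"
  proof
    fix j assume "j \<in> ?J"
    then have j: "2 \<le> j" "j \<le> n" and ne: "good k (x \<otimes> s j) \<noteq> good k x" by auto
    let ?b = "\<lambda>i. inverted (x \<otimes> s j) i \<noteq> (k dvd i)"
    have ne': "and_of_ors k pairs ?b \<noteq> and_of_ors k pairs b"
      using ne P_mult_gen_n[OF x j] unfolding good_def b_def by blast
    have same: "?b i = b i" if "{P x (2 * i), P x (Suc (2 * i))} \<noteq> {j - 2, Suc (j - 2)}" for i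
      using inverted_mult_gen[OF x j that] by (simp add: b_def)
    obtain i where i: "i < pairs" "?b i \<noteq> b i"
      using ne' and_of_ors_cong[of pairs ?b b k] by blast
    then have pi: "{P x (2 * i), P x (Suc (2 * i))} = {j - 2, Suc (j - 2)}" using same by blast
    have "?b l = (b(i := \<not> b i)) l" for l
    proof (cases "l = i")
      case True
      then show ?thesis using i(2) by auto
    next
      case False
      \<comment> \<open>Distinct pairs of positions are disjoint, so they cannot carry the same two
        values.\<close>
      have "{P x (2 * l), P x (Suc (2 * l))} \<noteq> {j - 2, Suc (j - 2)}"
      proof
        assume "{P x (2 * l), P x (Suc (2 * l))} = {j - 2, Suc (j - 2)}"
        then have "P x (2 * l) = P x (2 * i) \<or> P x (2 * l) = P x (Suc (2 * i))"
          using pi by (auto simp: doubleton_eq_iff)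
        then have "2 * l = 2 * i \<or> 2 * l = Suc (2 * i)" unfolding P_eq_iff[OF x] .
        then show False using False by presburger
      qed
      then show ?thesis using same[of l] False by auto
    qed
    then have "?b = b(i := \<not> b i)" by blast
    then have "i \<in> ?S" using ne' i(1) by simp
    moreover have "j = ?g i" using pi j by (auto simp: doubleton_eq_iff)
    ultimately show "j \<in> ?g ` ?S" by blast
  qed
  then have "card ?J \<le> card (?g ` ?S)" by (intro card_mono) auto
  also have "\<dots> \<le> card ?S" by (rule card_image_le) simp
  also have "\<dots> \<le> k" by (rule and_of_ors_sensitivity[OF k])
  finally show ?thesis .
qed

lemma sigma_graph_le:
  assumes k: "0 < k" "pairs \<le> k * k"
  shows "sigma graph \<le> k + 1"
proof (rule sigma_le[where K = "large k"])
  show "finite (pverts graph)" using finite_carrier by (simp add: cayley_graph_def)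
  show "large k \<subseteq> pverts graph" by (auto simp: large_def cayley_graph_def)
  show "independence_number graph < card (large k)"
    using card_large[OF k(1)] independence_number_graph by linarith
  fix x assume x: "x \<in> large k"
  then have xc: "x \<in> carrier G" by (simp add: large_def)
  let ?J = "{j \<in> {2..n}. good k (x \<otimes> s j) \<noteq> good k x}"
  have "{y \<in> large k. (x, y) \<in> parcs graph} \<subseteq> (\<lambda>j. x \<otimes> s j) ` insert 1 ?J"
  proof
    fix y assume "y \<in> {y \<in> large k. (x, y) \<in> parcs graph}"
    then obtain j where j: "1 \<le> j" "j \<le> n" "y = x \<otimes> s j" and y: "y \<in> large k"
      unfolding graph_arc_iff by auto
    have "parity y = - parity x" unfolding j(3) using xc j(1,2) by (rule parity_mult_gen)
    then have "good k y \<noteq> good k x" using x y parity_cases[of x] by (auto simp: large_def)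
    then have "j \<in> insert 1 ?J" using j by auto
    then show "y \<in> (\<lambda>j. x \<otimes> s j) ` insert 1 ?J" using j(3) by blast
  qed
  then have "card {y \<in> large k. (x, y) \<in> parcs graph} \<le> card ((\<lambda>j. x \<otimes> s j) ` insert 1 ?J)"
    by (intro card_mono) auto
  also have "\<dots> \<le> card (insert 1 ?J)" by (rule card_image_le) simp
  also have "\<dots> \<le> Suc (card ?J)" by (rule card_insert_le_m1) auto
  also have "\<dots> \<le> k + 1" using card_good_change[OF xc k(2)] by simp
  finally show "card {y \<in> large k. (x, y) \<in> parcs graph} \<le> k + 1" .
qed

section \<open>A cube in the Cayley graph\<close>

primrec cube_vertex :: "nat \<Rightarrow> bool list \<Rightarrow> 'a" where
  "cube_vertex j [] = \<one>"
| "cube_vertex j (b # bs) = (if b then s (2 * j + 2) else \<one>) \<otimes> cube_vertex (Suc j) bs"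

lemma cube_vertex_closed: "j + length bs \<le> pairs \<Longrightarrow> cube_vertex j bs \<in> carrier G"
proof (induction bs arbitrary: j)
  case (Cons b bs)
  then show ?case using pair_gen[of j] gen_closed_2 by auto
qed simp

lemma cube_vertex_commute:
  "i < j \<Longrightarrow> j + length bs \<le> pairs \<Longrightarrow>
    s (2 * i + 2) \<otimes> cube_vertex j bs = cube_vertex j bs \<otimes> s (2 * i + 2)"
proof (induction bs arbitrary: j)
  case Nil
  then show ?case using pair_gen[of i] gen_closed_2 by simp
next
  case (Cons b bs)
  let ?i = "s (2 * i + 2)" and ?j = "s (2 * j + 2)" and ?v = "cube_vertex (Suc j) bs"
  have c: "?i \<in> carrier G" "?j \<in> carrier G" "?v \<in> carrier G"
    using Cons.prems pair_gen[of i] pair_gen[of j] by (auto intro!: gen_closed_2 cube_vertex_closed)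
  have IH: "?i \<otimes> ?v = ?v \<otimes> ?i" using Cons by simp
  show ?case
  proof (cases b)
    case True
    have ij: "?i \<otimes> ?j = ?j \<otimes> ?i"
      using Cons.prems pair_gen[of j] by (intro gen_commute) auto
    have "?i \<otimes> (?j \<otimes> ?v) = ?i \<otimes> ?j \<otimes> ?v" by (rule m_assoc[symmetric, OF c])
    also have "\<dots> = ?j \<otimes> (?i \<otimes> ?v)" unfolding ij by (rule m_assoc[OF c(2,1,3)])
    also have "\<dots> = ?j \<otimes> ?v \<otimes> ?i" unfolding IH by (rule m_assoc[symmetric, OF c(2,3,1)])
    finally show ?thesis using True by simp
  qed (use IH c in simp)
qed

text \<open>The factors are commuting involutions, so inserting or deleting one anywhere is right
  multiplication by it. The offset \<open>j\<close> carries the induction over the list.\<close>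

lemma cube_vertex_flip:
  "i < length bs \<Longrightarrow> j + length bs \<le> pairs \<Longrightarrow>
    cube_vertex j (bs[i := \<not> bs ! i]) = cube_vertex j bs \<otimes> s (2 * (j + i) + 2)"
proof (induction bs arbitrary: i j)
  case (Cons b bs)
  let ?v = "cube_vertex (Suc j) bs"
  have c: "s (2 * j + 2) \<in> carrier G" "?v \<in> carrier G"
    using Cons.prems pair_gen[of j] by (auto intro!: gen_closed_2 cube_vertex_closed)
  show ?case
  proof (cases i)
    case 0
    have com: "s (2 * j + 2) \<otimes> ?v = ?v \<otimes> s (2 * j + 2)"
      using Cons.prems by (intro cube_vertex_commute) auto
    have "s (2 * j + 2) \<otimes> ?v \<otimes> s (2 * j + 2) = ?v"
      unfolding com using c pair_gen[of j] Cons.prems by (intro mult_gen_gen) auto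
    then show ?thesis using 0 c com by simp
  next
    case (Suc l)
    have cl: "s (2 * (Suc j + l) + 2) \<in> carrier G"
      using Cons.prems pair_gen[of "Suc j + l"] Suc by (intro gen_closed_2) auto
    have "cube_vertex (Suc j) (bs[l := \<not> bs ! l]) = ?v \<otimes> s (2 * (Suc j + l) + 2)"
      using Cons.prems Suc by (intro Cons.IH) auto
    then show ?thesis using Suc c cl by (simp add: m_assoc)
  qed
qed simp

text \<open>Serves to show injectivity: the factors act on disjoint pairs, so bit \<open>i\<close>
  is true exactly if the point \<open>2 * (j + i)\<close> is moved.\<close>

lemma P_cube_vertex:
  "j + length bs \<le> pairs \<Longrightarrow>
    P (cube_vertex j bs) l = (if j \<le> l div 2 \<and> l div 2 < j + length bs \<and> bs ! (l div 2 - j)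
      then if even l then Suc l else l - 1 else l)"
proof (induction bs arbitrary: j l)
  case Nil
  then show ?case by (simp add: P_one)
next
  case (Cons b bs)
  let ?t = "transpose (2 * j) (Suc (2 * j))" and ?v = "cube_vertex (Suc j) bs"
  have j: "j < pairs" using Cons.prems by simp
  have c: "s (2 * j + 2) \<in> carrier G" "?v \<in> carrier G"
    using Cons.prems pair_gen[of j] by (auto intro!: gen_closed_2 cube_vertex_closed)
  have "P (s (2 * j + 2) \<otimes> ?v) l = P ?v (?t l)"
    using P_mult[OF c] unfolding P_pair_gen[OF j] by simp
  then have P: "P (cube_vertex j (b # bs)) l = P ?v (if b then ?t l else l)"
    using c by simp
  have IH: "P ?v l = (if Suc j \<le> l div 2 \<and> l div 2 < Suc j + length bs \<and> bs ! (l div 2 - Suc j)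
      then if even l then Suc l else l - 1 else l)" for l
    using Cons by simp
  show ?case
  proof (cases "l div 2 = j")
    case True
    then have "l = 2 * j \<or> l = Suc (2 * j)" by presburger
    then show ?thesis unfolding P by (auto simp: IH)
  next
    case False
    then have "?t l = l" by (intro transpose_apply_other) auto
    then have "P (cube_vertex j (b # bs)) l = P ?v l" unfolding P by simp
    also have "\<dots> = (if Suc j \<le> l div 2 \<and> l div 2 < Suc j + length bs \<and> bs ! (l div 2 - Suc j)
        then if even l then Suc l else l - 1 else l)" by (rule IH)
    finally have P': "P (cube_vertex j (b # bs)) l = \<dots>" .
    show ?thesis
    proof (cases "Suc j \<le> l div 2")
      case True
      then show ?thesis unfolding P' by (simp add: nth_Cons')
    next
      case j': False
      then have "\<not> j \<le> l div 2" using False by simp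
      with j' show ?thesis unfolding P' by simp
    qed
  qed
qed

lemma kappa_graph_ge: "pairs \<le> kappa graph"
proof (rule kappa_ge[where f = "cube_vertex 0"])
  show "finite (pverts graph)" using finite_carrier by (simp add: cayley_graph_def)
  show "parcs graph \<subseteq> pverts graph \<times> pverts graph" by (auto simp: cayley_graph_def)
  show "cube_vertex 0 ` pverts (hypercube pairs) \<subseteq> pverts graph"
    using cube_vertex_closed[of 0] by (auto simp: cayley_graph_def hypercube_def)
  show "inj_on (cube_vertex 0) (pverts (hypercube pairs))"
  proof (rule inj_onI, rule nth_equalityI)
    fix x y i assume xy: "x \<in> pverts (hypercube pairs)" "y \<in> pverts (hypercube pairs)"
      "cube_vertex 0 x = cube_vertex 0 y"
    then show "length x = length y" by (simp add: hypercube_def)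
    assume "i < length x"
    then show "x ! i = y ! i"
      using xy P_cube_vertex[of 0 x "2 * i"] P_cube_vertex[of 0 y "2 * i"]
      by (auto simp: hypercube_def split: if_splits)
  qed
  fix x y assume xy: "(x, y) \<in> parcs (hypercube pairs)"
  then have len: "length x = pairs" by (simp add: hypercube_def)
  from hypercube_arc_flip[OF xy] obtain i where i: "i < pairs" "y = x[i := \<not> x ! i]" by blast
  then have "cube_vertex 0 y = cube_vertex 0 x \<otimes> s (2 * i + 2)"
    using cube_vertex_flip[of i x 0] len by simp
  then show "(cube_vertex 0 x, cube_vertex 0 y) \<in> parcs graph"
    unfolding graph_arc_iff using cube_vertex_closed[of 0 x] len pair_gen[OF i(1)] by auto
qed

lemma sigma_graph_le_kappa: "int (sigma graph) \<le> \<lceil>sqrt (real (kappa graph))\<rceil> + 1"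
proof -
  \<comment> \<open>This makes at most \<open>k\<close> blocks of length at most \<open>k\<close>;
    the bound passes to \<open>kappa graph\<close> by monotonicity, as
    \<open>pairs \<le> kappa graph\<close>.\<close>
  define k where "k = nat \<lceil>sqrt (real pairs)\<rceil>"
  have "0 < pairs" using two_le_n by (simp add: pairs_def)
  then have "0 < sqrt (real pairs)" by simp
  then have k0: "0 < k" by (simp add: k_def)
  have k_real: "sqrt (real pairs) \<le> real k" unfolding k_def by (rule real_nat_ceiling_ge)
  then have "sqrt (real pairs) ^ 2 \<le> real k ^ 2" by (intro power_mono) auto
  then have "real pairs \<le> real (k * k)" by (simp add: power2_eq_square)
  then have "pairs \<le> k * k" by (simp only: of_nat_le_iff)
  then have "sigma graph \<le> k + 1" by (rule sigma_graph_le[OF k0])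
  moreover have "int k \<le> \<lceil>sqrt (real (kappa graph))\<rceil>"
  proof -
    have "\<lceil>sqrt (real pairs)\<rceil> \<le> \<lceil>sqrt (real (kappa graph))\<rceil>"
      using kappa_graph_ge by (intro ceiling_mono) simp
    moreover have "int k = \<lceil>sqrt (real pairs)\<rceil>" unfolding k_def using \<open>0 < sqrt (real pairs)\<close> by linarith
    ultimately show ?thesis by simp
  qed
  ultimately show ?thesis by simp
qed

end

section \<open>The presented groups\<close>

definition comp_list :: "('a \<Rightarrow> 'a) list \<Rightarrow> 'a \<Rightarrow> 'a" where
  "comp_list fs = foldr (\<circ>) fs id"

lemma comp_list_simps [simp]:
  "comp_list [] = id"
  "comp_list (f # fs) = f \<circ> comp_list fs"
  by (simp_all add: comp_list_def)

interpretation fun_comp: monoid_mult id "(\<circ>)"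
  rewrites "monoid_mult.prod_list id (\<circ>) = comp_list"
proof -
  show fc: "class.monoid_mult id ((\<circ>) :: ('a \<Rightarrow> 'a) \<Rightarrow> _)"
    by unfold_locales (simp_all add: comp_assoc)
  interpret monoid_mult id "(\<circ>) :: ('a \<Rightarrow> 'a) \<Rightarrow> _" by (rule fc)
  show "monoid_mult.prod_list id (\<circ>) = (comp_list :: ('a \<Rightarrow> 'a) list \<Rightarrow> _)"
  proof
    fix fs :: "('a \<Rightarrow> 'a) list"
    show "prod_list fs = comp_list fs"
      by (induction fs) (simp_all only: prod_list.Nil prod_list.Cons comp_list_simps)
  qed
qed

section \<open>The permutation action of words\<close>

lemma pair_power_eq_map:
  "pair_power i j 2 = map (\<lambda>a. (a, True)) [i, j, i, j]"
  "pair_power i j 3 = map (\<lambda>a. (a, True)) [i, j, i, j, i, j]"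
  "pair_power i j 4 = map (\<lambda>a. (a, True)) [i, j, i, j, i, j, i, j]"
  by (simp_all add: pair_power_def numeral_eq_Suc)

text \<open>Exponents of letters can be ignored because transpositions are involutions. The reversed
  order of composition produces an antihomomorphism.\<close>

primrec word_perm :: "(nat \<Rightarrow> nat) \<Rightarrow> nat gword \<Rightarrow> nat \<Rightarrow> nat" where
  "word_perm c [] = id"
| "word_perm c (l # w) = word_perm c w \<circ> transpose (c (fst l)) (Suc (c (fst l)))"

lemma word_perm_append: "word_perm c (u @ v) = word_perm c v \<circ> word_perm c u"
  by (induction u) (simp_all add: comp_assoc)

text \<open>The hypothesis says that the two transpositions are equal or disjoint; equality occurs
  for the generators 1 and 2 in type D.\<close>

lemma word_perm_commuting:
  assumes "c i = c j \<or> Suc (c i) < c j \<or> Suc (c j) < c i"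
  shows "word_perm c (pair_power i j 2) = id"
  using assms unfolding pair_power_eq_map by (auto simp: fun_eq_iff transpose_def)

lemma word_perm_braid:
  assumes "c j = Suc (c i)"
  shows "word_perm c (pair_power i j 3) = id"
  using assms unfolding pair_power_eq_map by (auto simp: fun_eq_iff transpose_def)

text \<open>The universal property of the presentation, with reversed multiplication of
  permutations.\<close>

lemma word_perm_pres_eq:
  assumes "pres_eq X R u v" and R: "\<And>r. r \<in> R \<Longrightarrow> word_perm c r = id"
  shows "word_perm c u = word_perm c v"
  using assms(1)
proof (induction rule: pres_eq.induct)
  case (cancel u v a b)
  then show ?case by (simp add: word_perm_append fun_eq_iff)
qed (simp_all add: word_perm_append R)

text \<open>Evaluates a chosen representative; the choice does not matter once all relators act
  trivially.\<close>

definition class_perm :: "(nat \<Rightarrow> nat) \<Rightarrow> nat gword set \<Rightarrow> nat \<Rightarrow> nat" where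
  "class_perm c A = word_perm c (SOME w. w \<in> A)"

lemma class_perm_pres_class:
  assumes "w \<in> gwords X" and R: "\<And>r. r \<in> R \<Longrightarrow> word_perm c r = id"
  shows "class_perm c (pres_class X R w) = word_perm c w"
proof -
  have "w \<in> pres_class X R w" using assms(1) by (simp add: pres_class_def pres_eq.refl)
  then have "(SOME v. v \<in> pres_class X R w) \<in> pres_class X R w" by (rule someI)
  then have "pres_eq X R w (SOME v. v \<in> pres_class X R w)" by (simp add: pres_class_def)
  from word_perm_pres_eq[OF this R] show ?thesis by (simp add: class_perm_def)
qed

section \<open>Groups presented with involutory generators\<close>

locale involution_presentation =
  fixes X :: "nat set" and R :: "nat gword set"
  assumes square: "a \<in> X \<Longrightarrow> [(a, True), (a, True)] \<in> R"
begin

abbreviation W :: "nat gword set monoid" where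
  "W \<equiv> presented_group X R"

abbreviation cls :: "nat gword \<Rightarrow> nat gword set" where
  "cls \<equiv> pres_class X R"

abbreviation gen :: "nat \<Rightarrow> nat gword set" where
  "gen a \<equiv> cls [(a, True)]"

abbreviation pos :: "nat list \<Rightarrow> nat gword" where
  "pos \<equiv> map (\<lambda>a. (a, True))"

text \<open>
  Left multiplication, extended by the identity outside the carrier: total functions form a
  monoid in the sense of the type class, to which the coset enumeration applies.
\<close>

definition lmult :: "nat \<Rightarrow> nat gword set \<Rightarrow> nat gword set" where
  "lmult a x = (if x \<in> carrier W then gen a \<otimes>\<^bsub>W\<^esub> x else x)"

lemma carrier_W: "carrier W = cls ` gwords X"
  and one_W: "\<one>\<^bsub>W\<^esub> = cls []"
  by (simp_all add: presented_group_def)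

lemma pos_in_gwords: "pos l \<in> gwords X \<longleftrightarrow> set l \<subseteq> X"
  by (induction l) auto

lemma cls_relator: "r \<in> R \<Longrightarrow> r \<in> gwords X \<Longrightarrow> cls r = cls []"
  using pres_eq.relator[of "[]" "X" "[]" r R] by (simp add: pres_class_eq_iff)

lemma prod_lmult:
  assumes "set l \<subseteq> X" "w \<in> gwords X"
  shows "comp_list (map lmult l) (cls w) = cls (pos l @ w)"
  using assms(1)
proof (induction l)
  case (Cons a l)
  then have "pos l @ w \<in> gwords X" using assms(2) by (simp add: pos_in_gwords)
  then show ?case using Cons by (simp add: lmult_def carrier_W presented_group_mult pos_in_gwords)
qed simp

lemma prod_lmult_outside: "x \<notin> carrier W \<Longrightarrow> comp_list (map lmult l) x = x"
  by (induction l) (simp_all add: lmult_def)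

text \<open>Off the carrier \<open>lmult\<close> does nothing, so relations of the group become
  equations between total functions.\<close>

lemma prod_lmult_relator:
  assumes "pos l \<in> R" "set l \<subseteq> X"
  shows "comp_list (map lmult l) = id"
proof
  fix x
  show "comp_list (map lmult l) x = id x"
  proof (cases "x \<in> carrier W")
    case True
    then obtain w where w: "w \<in> gwords X" "x = cls w" by (auto simp: carrier_W)
    have "cls (pos l @ w) = cls w"
      using pres_eq.relator[of "[]" "X" w "pos l" R] assms w(1)
      by (simp add: pres_class_eq_iff pos_in_gwords)
    then show ?thesis using prod_lmult[OF assms(2) w(1)] w(2) by simp
  qed (simp add: prod_lmult_outside)
qed

lemma lmult_square: "a \<in> X \<Longrightarrow> lmult a \<circ> lmult a = id"
  using prod_lmult_relator[of "[a, a]"] square by simp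

lemma lmult_commute:
  assumes "pair_power i j 2 \<in> R" "{i, j} \<subseteq> X"
  shows "lmult i \<circ> lmult j = lmult j \<circ> lmult i"
proof (rule fun_comp.involutions_commute)
  show "lmult i \<circ> (lmult j \<circ> (lmult i \<circ> lmult j)) = id"
    using prod_lmult_relator[of "[i, j, i, j]"] assms by (simp add: pair_power_eq_map)
qed (use assms lmult_square in auto)

lemma lmult_braid:
  assumes "pair_power i j 3 \<in> R" "{i, j} \<subseteq> X"
  shows "lmult i \<circ> lmult j \<circ> lmult i = lmult j \<circ> lmult i \<circ> lmult j"
proof (rule fun_comp.involutions_braid3)
  show "lmult i \<circ> (lmult j \<circ> (lmult i \<circ> (lmult j \<circ> (lmult i \<circ> lmult j)))) = id"
    using prod_lmult_relator[of "[i, j, i, j, i, j]"] assms by (simp add: pair_power_eq_map)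
qed (use assms lmult_square in auto)

lemma lmult_braid4:
  assumes "pair_power i j 4 \<in> R" "{i, j} \<subseteq> X"
  shows "lmult i \<circ> lmult j \<circ> lmult i \<circ> lmult j = lmult j \<circ> lmult i \<circ> lmult j \<circ> lmult i"
proof (rule fun_comp.involutions_braid4)
  show "lmult i \<circ> (lmult j \<circ> (lmult i \<circ> (lmult j \<circ> (lmult i \<circ> (lmult j \<circ> (lmult i \<circ> lmult j)))))) = id"
    using prod_lmult_relator[of "[i, j, i, j, i, j, i, j]"] assms by (simp add: pair_power_eq_map)
qed (use assms lmult_square in auto)

text \<open>An involution equals its inverse. The coset enumeration deals with positive words
  only.\<close>

lemma pres_eq_positive: "w \<in> gwords X \<Longrightarrow> pres_eq X R w (pos (map fst w))"
proof (induction w)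
  case Nil
  then show ?case by (simp add: pres_eq.refl)
next
  case (Cons l w)
  obtain a b where l: "l = (a, b)" by (cases l)
  have a: "a \<in> X" "w \<in> gwords X" using Cons.prems by (auto simp: l)
  have "pres_eq X R [(a, False)] [(a, True)]"
  proof -
    have "pres_eq X R ([(a, False)] @ [(a, True), (a, True)] @ []) ([(a, False)] @ [])"
      using a square by (intro pres_eq.relator) auto
    moreover have "pres_eq X R ([] @ [(a, False), (a, \<not> False)] @ [(a, True)]) ([] @ [(a, True)])"
      using a by (intro pres_eq.cancel) auto
    ultimately show ?thesis by simp (metis pres_eq.sym pres_eq.trans)
  qed
  then have "pres_eq X R [(a, b)] [(a, True)]"
    using a by (cases b) (auto intro: pres_eq.refl)
  from pres_eq_append[OF this Cons.IH[OF a(2)]] show ?case by (simp add: l)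
qed

text \<open>A product of functions \<open>lmult a\<close>, evaluated at the class of the empty word,
  gives the class of the word, so finitely many functions yield all elements.\<close>

lemma finite_carrier_W:
  assumes "finite (fun_comp.words lmult n)" and X: "X = {1..n}"
  shows "finite (carrier W)"
proof (rule finite_subset)
  show "finite ((\<lambda>f. f (cls [])) ` fun_comp.words lmult n)" by (rule finite_imageI[OF assms(1)])
  show "carrier W \<subseteq> (\<lambda>f. f (cls [])) ` fun_comp.words lmult n"
  proof
    fix x assume "x \<in> carrier W"
    then obtain w where w: "w \<in> gwords X" "x = cls w" by (auto simp: carrier_W)
    let ?l = "map fst w"
    have pw: "pres_eq X R w (pos ?l)" using w(1) by (rule pres_eq_positive)
    then have "pos ?l \<in> gwords X" using pres_eq_gwords by blast
    then have l: "set ?l \<subseteq> X" and "cls w = cls (pos ?l)"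
      using pw by (simp_all only: pres_class_eq_iff pos_in_gwords)
    then have "x = comp_list (map lmult ?l) (cls [])"
      using prod_lmult[OF l, of "[]"] w(2) by simp
    moreover have "comp_list (map lmult ?l) \<in> fun_comp.words lmult n"
      unfolding fun_comp.words_def using l X by (intro imageI) auto
    ultimately show "x \<in> (\<lambda>f. f (cls [])) ` fun_comp.words lmult n" by blast
  qed
qed

text \<open>The types differ only in the relators and in \<open>c 1\<close>, which is
  \<open>n\<close> in type B and \<open>0\<close> in type D. By the bounds on \<open>c 1\<close>, no
  transposition exchanges \<open>n - 1\<close> with \<open>n\<close>, as \<open>P_less\<close>
  requires.\<close>

lemma sigma_cayley_le_kappa:
  assumes X: "X = {1..n}" and fin: "finite (carrier W)" and n: "2 \<le> n"
    and comm: "\<And>i j. 2 \<le> i \<Longrightarrow> i + 2 \<le> j \<Longrightarrow> j \<le> n \<Longrightarrow> pair_power i j 2 \<in> R"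
    and c: "\<And>j. 2 \<le> j \<Longrightarrow> j \<le> n \<Longrightarrow> c j = j - 2"
    and c1: "c 1 \<le> n" "c 1 \<noteq> n - 1"
    and R: "\<And>r. r \<in> R \<Longrightarrow> word_perm c r = id"
  defines "H \<equiv> cayley_graph W (presented_gens X R)"
  shows "int (sigma H) \<le> \<lceil>sqrt (real (kappa H))\<rceil> + 1"
proof -
  have c_bound: "Suc (c a) < n \<or> c a = n" if "a \<in> X" for a
    using that[unfolded X] c[of a] c1 by (cases "a = 1") auto
  have mem: "a \<in> X" if "1 \<le> a" "a \<le> n" for a
    using that X by simp
  interpret group W by (rule group_presented_group)
  interpret permutation_cayley W gen n "class_perm c"
  proof
    show "finite (carrier W)" by (rule fin)
    show "2 \<le> n" by (rule n)
    show "gen i \<in> carrier W" if "1 \<le> i" "i \<le> n" for i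
      unfolding carrier_W using mem[OF that] by (intro imageI) simp
    show "gen i \<otimes>\<^bsub>W\<^esub> gen i = \<one>\<^bsub>W\<^esub>" if "1 \<le> i" "i \<le> n" for i
      using mem[OF that] square[OF mem[OF that]] cls_relator[of "[(i, True), (i, True)]"]
      by (simp add: one_W presented_group_mult)
    show "gen i \<otimes>\<^bsub>W\<^esub> gen j = gen j \<otimes>\<^bsub>W\<^esub> gen i" if "2 \<le> i" "i + 2 \<le> j" "j \<le> n" for i j
    proof -
      \<comment> \<open>Evaluating this equation at the class of the empty word gives the relation
        in the group.\<close>
      have "lmult i \<circ> lmult j = lmult j \<circ> lmult i"
        using that by (intro lmult_commute comm) (auto intro: mem)
      then have "comp_list (map lmult [i, j]) (cls []) = comp_list (map lmult [j, i]) (cls [])"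
        by simp
      then have "cls (pos [i, j] @ []) = cls (pos [j, i] @ [])"
        using that prod_lmult[of "[i, j]" "[]"] prod_lmult[of "[j, i]" "[]"] mem[of i] mem[of j] by simp
      then show ?thesis using that mem[of i] mem[of j] by (simp add: presented_group_mult)
    qed
    show "class_perm c (x \<otimes>\<^bsub>W\<^esub> y) = class_perm c y \<circ> class_perm c x"
      if "x \<in> carrier W" "y \<in> carrier W" for x y
      using that by (auto simp: carrier_W presented_group_mult class_perm_pres_class R word_perm_append)
    show "class_perm c x permutes {..Suc n}" if "x \<in> carrier W" for x
    proof -
      have "word_perm c w permutes {..Suc n}" if "w \<in> gwords X" for w
        using that
      proof (induction w)
        case (Cons l w)
        obtain a b where l: "l = (a, b)" by (cases l)
        have "transpose (c a) (Suc (c a)) permutes {..Suc n}"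
          by (rule permutes_swap_id) (use Cons.prems c_bound[of a] in \<open>auto simp: l\<close>)
        moreover have "word_perm c w permutes {..Suc n}" using Cons by (simp add: l)
        ultimately show ?case unfolding word_perm.simps l fst_conv by (rule permutes_compose)
      qed (simp add: permutes_id)
      then show ?thesis using that by (auto simp: carrier_W class_perm_pres_class R)
    qed
    show "class_perm c x i < n" if "x \<in> carrier W" "i < n" for x i
    proof -
      have "word_perm c w i < n" if "w \<in> gwords X" "i < n" for w i
        using that
      proof (induction w arbitrary: i)
        case (Cons l w)
        obtain a b where l: "l = (a, b)" by (cases l)
        have "transpose (c a) (Suc (c a)) i < n"
          using c_bound[of a] Cons.prems by (auto simp: transpose_def l)
        then show ?case using Cons by (simp add: l)
      qed simp
      then show ?thesis using that by (auto simp: carrier_W class_perm_pres_class R)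
    qed
    have gen_perm: "class_perm c (gen i) = transpose (c i) (Suc (c i))" if "i \<in> X" for i
      using that by (subst class_perm_pres_class) (auto simp: R)
    show "class_perm c (gen i) = transpose (i - 2) (i - 1)" if "2 \<le> i" "i \<le> n" for i
    proof -
      have "Suc (i - 2) = i - 1" using that by simp
      then show ?thesis using that gen_perm[of i] c[of i] mem[of i] by simp
    qed
    show "sign (class_perm c (gen 1)) = - 1"
      using gen_perm[of 1] n mem[of 1] by (simp add: sign_swap_id)
  qed
  have "H = graph" unfolding H_def presented_gens_def X ..
  then show ?thesis using sigma_graph_le_kappa by simp
qed

end

section \<open>The two types\<close>

lemma sigma_cayley_B:
  assumes n: "2 \<le> n"
  shows "int (sigma (cayley_B n)) \<le> \<lceil>sqrt (real (kappa (cayley_B n)))\<rceil> + 1"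
proof -
  interpret involution_presentation "{1..n}" "B_relators n"
  proof
    fix a assume "a \<in> {1..n}"
    then show "[(a, True), (a, True)] \<in> B_relators n"
      unfolding B_relators_def by (intro UnI1 CollectI exI[of _ a]) auto
  qed
  have comm: "pair_power i j 2 \<in> B_relators n" if "1 \<le> i" "i + 2 \<le> j" "j \<le> n" for i j
    unfolding B_relators_def
    by (rule UnI2, intro CollectI exI conjI, rule HOL.refl) (use that in auto)
  have braid: "pair_power i (Suc i) 3 \<in> B_relators n" if "2 \<le> i" "i < n" for i
    unfolding B_relators_def
    by (rule UnI1, rule UnI2, intro CollectI exI conjI) (use that in auto)
  have braid4: "pair_power 1 2 4 \<in> B_relators n" by (simp add: B_relators_def)
  have "finite (fun_comp.words lmult n)"
  proof (rule fun_comp.finite_words_B)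
    show "lmult i \<circ> lmult i = id" if "1 \<le> i" "i \<le> n" for i
      using that by (intro lmult_square) simp
    show "lmult i \<circ> lmult j = lmult j \<circ> lmult i" if "1 \<le> i" "i + 2 \<le> j" "j \<le> n" for i j
      using that by (intro lmult_commute comm) auto
    show "lmult i \<circ> lmult (Suc i) \<circ> lmult i = lmult (Suc i) \<circ> lmult i \<circ> lmult (Suc i)"
      if "2 \<le> i" "i < n" for i
      using that by (intro lmult_braid braid) auto
    show "lmult 2 \<circ> lmult 1 \<circ> lmult 2 \<circ> lmult 1 = lmult 1 \<circ> lmult 2 \<circ> lmult 1 \<circ> lmult 2"
      using n by (intro lmult_braid4[OF braid4, symmetric]) auto
  qed simp
  then have fin: "finite (carrier W)" by (rule finite_carrier_W) (rule HOL.refl)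
  \<comment> \<open>The transposition of \<open>n\<close> and \<open>Suc n\<close> is disjoint from
    the images of the other generators.\<close>
  let ?c = "\<lambda>j::nat. if j = 1 then n else j - 2"
  show ?thesis
    unfolding cayley_B_def
  proof (rule sigma_cayley_le_kappa[where c = ?c, OF HOL.refl fin n])
    fix r assume "r \<in> B_relators n"
    then consider i where "r = [(i, True), (i, True)]" | "r = pair_power 1 2 4"
      | i where "2 \<le> i" "i + 1 \<le> n" "r = pair_power i (i + 1) 3"
      | i j where "i \<in> {1..n}" "j \<in> {1..n}" "\<bar>int i - int j\<bar> \<ge> 2" "r = pair_power i j 2"
      unfolding B_relators_def by blast
    then show "word_perm ?c r = id"
    proof cases
      case 1
      then show ?thesis by (simp add: fun_eq_iff)
    next
      case 2
      \<comment> \<open>The images of 1 and 2 commute, so already the square of their product is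
        trivial.\<close>
      have "pair_power 1 2 4 = pair_power 1 2 2 @ pair_power (1::nat) 2 2"
        unfolding pair_power_eq_map by simp
      moreover have "word_perm ?c (pair_power 1 2 2) = id"
        using n by (intro word_perm_commuting) auto
      ultimately show ?thesis by (simp add: 2 word_perm_append)
    next
      case 3
      then show ?thesis by (auto intro!: word_perm_braid)
    next
      case 4
      then show ?thesis unfolding 4 by (intro word_perm_commuting) auto
    qed
  qed (use n comm in auto)
qed

lemma sigma_cayley_D:
  assumes n: "3 \<le> n"
  shows "int (sigma (cayley_D n)) \<le> \<lceil>sqrt (real (kappa (cayley_D n)))\<rceil> + 1"
proof -
  interpret involution_presentation "{1..n}" "D_relators n"
  proof
    fix a assume "a \<in> {1..n}"
    then show "[(a, True), (a, True)] \<in> D_relators n"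
      unfolding D_relators_def by (intro UnI1 CollectI exI[of _ a]) auto
  qed
  have comm: "pair_power i j 2 \<in> D_relators n"
    if "1 \<le> i" "i < j" "j \<le> n" "(i, j) \<notin> D_edges n" for i j
  proof -
    have "(j, i) \<notin> D_edges n" using that by (auto simp: D_edges_def)
    then show ?thesis
      unfolding D_relators_def
      by (intro UnI2 CollectI exI[of _ i] exI[of _ j]) (use that in auto)
  qed
  \<comment> \<open>The bound \<open>4 \<le> j\<close> excludes the edge from 1 to 3, the only one
    whose ends differ by two.\<close>
  have far: "(i, j) \<notin> D_edges n" if "i + 2 \<le> j" "4 \<le> j" for i j
    using that by (auto simp: D_edges_def)
  have braid: "pair_power i j 3 \<in> D_relators n" if "(i, j) \<in> D_edges n" for i j
    using that unfolding D_relators_def by blast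
  have n2: "2 \<le> n" using n by simp
  have "finite (fun_comp.words lmult n)"
  proof (rule fun_comp.finite_words_D[where n = n])
    show "lmult i \<circ> lmult i = id" if "1 \<le> i" "i \<le> n" for i
      using that by (intro lmult_square) simp
    show "lmult i \<circ> lmult j = lmult j \<circ> lmult i" if "1 \<le> i" "i + 2 \<le> j" "4 \<le> j" "j \<le> n" for i j
      using that by (intro lmult_commute comm far) auto
    show "lmult 1 \<circ> lmult 2 = lmult 2 \<circ> lmult 1"
      using n by (intro lmult_commute comm) (auto simp: D_edges_def)
    show "lmult i \<circ> lmult (Suc i) \<circ> lmult i = lmult (Suc i) \<circ> lmult i \<circ> lmult (Suc i)"
      if "3 \<le> i" "i < n" for i
      using that by (intro lmult_braid braid) (auto simp: D_edges_def)
    show "lmult 1 \<circ> lmult 3 \<circ> lmult 1 = lmult 3 \<circ> lmult 1 \<circ> lmult 3"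
      using n by (intro lmult_braid braid) (auto simp: D_edges_def)
    show "lmult 2 \<circ> lmult 3 \<circ> lmult 2 = lmult 3 \<circ> lmult 2 \<circ> lmult 3"
      using n by (intro lmult_braid braid) (auto simp: D_edges_def)
  qed (use n in auto)
  then have fin: "finite (carrier W)" by (rule finite_carrier_W) (rule HOL.refl)
  \<comment> \<open>Truncated subtraction gives \<open>?c 1 = ?c 2 = 0\<close>: the generators 1 and
    2 have the same image, which braids with that of 3.\<close>
  let ?c = "\<lambda>j::nat. j - 2"
  show ?thesis
    unfolding cayley_D_def
  proof (rule sigma_cayley_le_kappa[where c = ?c, OF HOL.refl fin n2])
    fix r assume "r \<in> D_relators n"
    then consider i where "r = [(i, True), (i, True)]"
      | i j where "(i, j) \<in> D_edges n" "r = pair_power i j 3"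
      | i j where "i \<in> {1..n}" "j \<in> {1..n}" "i \<noteq> j" "(i, j) \<notin> D_edges n" "(j, i) \<notin> D_edges n"
          "r = pair_power i j 2"
      unfolding D_relators_def by blast
    then show "word_perm ?c r = id"
    proof cases
      case 1
      then show ?thesis by (simp add: fun_eq_iff)
    next
      case 2
      then show ?thesis unfolding 2(2) by (intro word_perm_braid) (auto simp: D_edges_def)
    next
      case 3
      \<comment> \<open>A non-edge with \<open>i < j\<close> has \<open>j \<noteq> 3\<close>; the
        only consecutive indices left are 1 and 2, whose images agree.\<close>
      have "?c i = ?c j \<or> Suc (?c i) < ?c j" if "i \<in> {1..n}" "j \<in> {1..n}" "i < j" "(i, j) \<notin> D_edges n" for i j
      proof -
        have "j \<noteq> Suc i \<or> i = 1" "j \<noteq> 3"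
          using that by (auto simp: D_edges_def)
        then show ?thesis using that by auto
      qed
      from this[of i j] this[of j i] 3 show ?thesis unfolding 3(6)
        by (intro word_perm_commuting) (metis nat_neq_iff)
    qed
  qed (use n comm far in auto)
qed

theorem theorem6p9:
  fixes G :: "nat gword set pair_pre_digraph"
  assumes "(\<exists>n\<ge>2. G = cayley_B n) \<or> (\<exists>n\<ge>3. G = cayley_D n)"
  shows "int (sigma G) \<le> \<lceil>sqrt (real (kappa G))\<rceil> + 1"
  using assms sigma_cayley_B sigma_cayley_D by blast

end
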